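(* Let $n,k$ be integers with $2\leq k\leq n-5$, and let $G$ be a connected graph of order $n$ (so $n\geq k+5$) with minimum degree $\delta\geq k+1$. If $$M_{2}(G)\geq\frac{1}{2}n^{4}-\frac{11}{2}n^{3}+\frac{6k+51}{2}n^{2}-\frac{24k+105}{2}n+k^{3}+3k^{2}+16k+41,$$ then $G$ is $k$-leaf-connected unless $G$ is (isomorphic to) a member of $\{K_{5}\vee5K_{1},\ K_{4}\vee4K_{1}\}$.
   Context: All graphs are finite, simple and undirected; the order of $G$ is $|V(G)|$. $d_G(v)$ is the degree of the vertex $v$ in $G$, and $\delta=\delta(G)$ is the minimum degree. The second Zagreb index is $M_{2}(G)=\sum_{uv\in E(G)}d_{G}(u)d_{G}(v)$. For $k\geq 2$, a graph $G$ with $|V(G)|\geq k+1$ is $k$-leaf-connected if for every subset $S\subseteq V(G)$ with $|S|=k$, $G$ has a spanning tree $T$ such that $S$ is precisely the set of leaves of $T$. For vertex-disjoint graphs $G$ and $H$, $G+H$ is their disjoint union, $tG$ is the disjoint union of $t$ copies of $G$, and the join $G\vee H$ is obtained from $G+H$ by adding all possible edges between $V(G)$ and $V(H)$. $K_n$ is the complete graph of order $n$. *)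

theory Defs
  imports Complex_Main "Graph_Theory.Graph_Theory"
begin

text \<open>
  A finite simple undirected graph is a \<^locale>\<open>pair_graph\<close>: a finite, loop-free, symmetric
  digraph without parallel arcs, in which the edge \<open>uv\<close> appears as the two arcs
  \<open>(u, v)\<close> and \<open>(v, u)\<close>. Hence the degree of a vertex is its out-degree.
\<close>

abbreviation degree :: "'a pair_pre_digraph \<Rightarrow> 'a \<Rightarrow> nat" where
  "degree G v \<equiv> out_degree (with_proj G) v"

definition min_degree :: "'a pair_pre_digraph \<Rightarrow> nat" where
  "min_degree G = Min (degree G ` pverts G)"

definition edges :: "'a pair_pre_digraph \<Rightarrow> 'a set set" where
  "edges G = {{u, v} | u v. (u, v) \<in> parcs G}"

text \<open>The product over the two-element set \<open>e = {u, v}\<close> is \<open>d(u) d(v)\<close>.\<close>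

definition second_zagreb :: "'a pair_pre_digraph \<Rightarrow> nat" where
  "second_zagreb G = (\<Sum>e\<in>edges G. \<Prod>v\<in>e. degree G v)"


text \<open>
  The predicates \<^const>\<open>forest\<close> and \<^const>\<open>spanning_tree\<close> of \<^theory>\<open>Graph_Theory.Digraph_Component\<close> speak about directed
  cycles, so that an edge, read as a pair of opposite arcs, is already a cycle of length two. In a
  symmetric digraph the cycles of the underlying undirected graph are the directed cycles of
  length at least three.
\<close>

definition undirected_tree :: "'a pair_pre_digraph \<Rightarrow> bool" where
  "undirected_tree T \<longleftrightarrow> pair_graph T \<and> Digraph_Component.connected (with_proj T) \<and>
     \<not> (\<exists>p. pre_digraph.cycle (with_proj T) p \<and> 3 \<le> length p)"

definition undirected_spanning_tree :: "'a pair_pre_digraph \<Rightarrow> 'a pair_pre_digraph \<Rightarrow> bool" where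
  "undirected_spanning_tree T G \<longleftrightarrow>
     undirected_tree T \<and> spanning (with_proj T) (with_proj G)"

definition leaves :: "'a pair_pre_digraph \<Rightarrow> 'a set" where
  "leaves T = {v \<in> pverts T. degree T v = 1}"

definition k_leaf_connected :: "nat \<Rightarrow> 'a pair_pre_digraph \<Rightarrow> bool" where
  "k_leaf_connected k G \<longleftrightarrow> k + 1 \<le> card (pverts G) \<and>
     (\<forall>S \<subseteq> pverts G. card S = k \<longrightarrow>
        (\<exists>T. undirected_spanning_tree T G \<and> leaves T = S))"


definition complete_graph :: "nat \<Rightarrow> nat pair_pre_digraph" where
  "complete_graph n = \<lparr> pverts = {..<n}, parcs = {(u, v). u < n \<and> v < n \<and> u \<noteq> v} \<rparr>"

definition disjoint_union ::
  "'a pair_pre_digraph \<Rightarrow> 'b pair_pre_digraph \<Rightarrow> ('a + 'b) pair_pre_digraph" where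
  "disjoint_union G H = \<lparr> pverts = pverts G <+> pverts H,
     parcs = map_prod Inl Inl ` parcs G \<union> map_prod Inr Inr ` parcs H \<rparr>"

definition copies :: "nat \<Rightarrow> 'a pair_pre_digraph \<Rightarrow> (nat \<times> 'a) pair_pre_digraph" where
  "copies t G = \<lparr> pverts = {..<t} \<times> pverts G,
     parcs = {((i, u), (i, v)) | i u v. i < t \<and> (u, v) \<in> parcs G} \<rparr>"

definition join ::
  "'a pair_pre_digraph \<Rightarrow> 'b pair_pre_digraph \<Rightarrow> ('a + 'b) pair_pre_digraph" where
  "join G H = (disjoint_union G H) \<lparr> parcs := parcs (disjoint_union G H)
     \<union> (Inl ` pverts G) \<times> (Inr ` pverts H) \<union> (Inr ` pverts H) \<times> (Inl ` pverts G) \<rparr>"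

abbreviation isomorphic :: "'a pair_pre_digraph \<Rightarrow> 'b pair_pre_digraph \<Rightarrow> bool" where
  "isomorphic G H \<equiv> digraph_iso (with_proj G) (with_proj H)"

lemma complete_digraph_complete_graph: "complete_digraph n (with_proj (complete_graph n))"
  unfolding complete_digraph_pair_def by (auto simp: complete_graph_def)

lemma pair_graph_complete_graph: "pair_graph (complete_graph n)"
  using complete_digraph_complete_graph by (rule pair_graphI_complete)

lemma parcs_subset:
  assumes "pair_graph G"
  shows "parcs G \<subseteq> pverts G \<times> pverts G"
proof -
  interpret pair_graph G by fact
  show ?thesis by (auto dest: in_arcsD1 in_arcsD2)
qed

lemma pair_graphI:
  assumes "finite (pverts G)" "parcs G \<subseteq> pverts G \<times> pverts G" "sym (parcs G)" "irrefl (parcs G)"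
  shows "pair_graph G"
proof
  show "finite (parcs G)"
    using assms(1,2) by (meson finite_SigmaI finite_subset)
qed (use assms in \<open>auto simp: symmetric_def irrefl_def\<close>)

lemma sym_parcs:
  assumes "pair_graph G"
  shows "sym (parcs G)"
proof -
  interpret pair_graph G by fact
  show ?thesis using sym_arcs by (simp add: symmetric_def)
qed

lemma irrefl_parcs:
  assumes "pair_graph G"
  shows "irrefl (parcs G)"
proof -
  interpret pair_graph G by fact
  show ?thesis using pair_no_loops by (force simp: irrefl_def)
qed

lemma finite_pverts:
  assumes "pair_graph G"
  shows "finite (pverts G)"
proof -
  interpret pair_graph G by fact
  show ?thesis by simp
qed

lemma pair_graph_copies:
  assumes "pair_graph G"
  shows "pair_graph (copies t G)"
  by (rule pair_graphI)
    (use parcs_subset[OF assms] sym_parcs[OF assms] irrefl_parcs[OF assms] finite_pverts[OF assms]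
      in \<open>auto simp: copies_def sym_def irrefl_def\<close>)

lemma pair_graph_join:
  assumes "pair_graph G" "pair_graph H"
  shows "pair_graph (join G H)"
  by (rule pair_graphI)
    (use assms[THEN parcs_subset] assms[THEN sym_parcs] assms[THEN irrefl_parcs]
      assms[THEN finite_pverts]
      in \<open>auto simp: join_def disjoint_union_def irrefl_def intro!: symI dest: symD\<close>)

lemma card_edge_eq_2:
  assumes "pair_graph G" "e \<in> edges G"
  shows "card e = 2"
proof -
  obtain u v where "e = {u, v}" "(u, v) \<in> parcs G"
    using assms(2) by (auto simp: edges_def)
  moreover from this have "u \<noteq> v"
    using irrefl_parcs[OF assms(1)] by (auto simp: irrefl_def)
  ultimately show ?thesis by simp
qed

end

theory Submission
  imports Defs
begin

text \<open>
  Suppose that for some \<open>k\<close>-set \<open>S\<close> the graph \<open>G\<close> has no spanning tree with leaf set \<open>S\<close>. The main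
  tool is a closure property: if \<open>d(u) + d(v) \<ge> n + k - 1\<close>, then adding the edge \<open>uv\<close> does not
  create such a tree (\<open>leaf_tree_remove_edge\<close>), because a tree that uses \<open>uv\<close> can be freed of this
  edge by an exchange that keeps all degrees (\<open>exchange_tree\<close>). Hence \<open>G\<close> lies in a maximal graph \<open>H\<close>
  without the tree, in which non-adjacent vertices have degree sum at most \<open>n + k - 2\<close>
  (\<open>saturated_supergraph\<close>), and Chvatal's argument extracts from \<open>H\<close> a partition into \<open>a = i + 1 - k\<close>
  vertices of degree at most \<open>i\<close>, \<open>b\<close> vertices of degree at most \<open>n - 1 - a\<close> and \<open>i\<close> further vertices,
  with \<open>a \<ge> 2\<close> and \<open>b \<ge> 1\<close> (\<open>low_degree_parts\<close>).

  Under these caps the second Zagreb index is at most that of \<open>K\<^sub>i \<or> (K\<^sub>b + aK\<^sub>1)\<close>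
  (\<open>arc_weight_cap\<close>). The threshold of the theorem is half the sum of the cubed degrees of this graph for
  \<open>a = 2\<close>, and it exceeds the bound if \<open>a = 2\<close> or \<open>b \<ge> 2\<close>.

  For \<open>b = 1\<close> and \<open>a \<ge> 3\<close> this comparison is not enough, and the saturation of \<open>H\<close> is used again. If
  one of the \<open>i\<close> vertices were not adjacent to all others, then its degree would be at most \<open>n - 3\<close>, since
  the vertex that it misses has degree at least \<open>k + 1\<close>, and the index would fall below the threshold
  (\<open>arc_weight_gap\<close>). So these \<open>i = k + a - 1\<close> vertices are adjacent to everything, and for \<open>k \<ge> 3\<close> the
  tree can be written down (\<open>leaf_tree_universal_part\<close>), a contradiction. For \<open>k = 2\<close> one has
  \<open>i = a + 1\<close>, and the first bound is at least the threshold only for \<open>a = 3\<close>, \<open>n = 8\<close>. There the slack is so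
  small that \<open>G\<close> itself must be \<open>K\<^sub>4 \<or> 4K\<^sub>1\<close> (\<open>complete_split_eight\<close>).
\<close>

section \<open>Spanning trees with a prescribed leaf set\<close>

text \<open>
  A tree is represented by its parent function: the rank decreasing from each vertex to its parent
  excludes cycles, and the exchange of two edges becomes an update of the function at two points.
\<close>

definition rooted_tree :: "'a set \<Rightarrow> 'a \<Rightarrow> ('a \<Rightarrow> 'a) \<Rightarrow> bool" where
  "rooted_tree V r p \<longleftrightarrow> finite V \<and> r \<in> V \<and> (\<forall>x\<in>V - {r}. p x \<in> V) \<and>
     (\<exists>h :: 'a \<Rightarrow> nat. \<forall>x\<in>V - {r}. h (p x) < h x)"

definition tree_arcs :: "'a set \<Rightarrow> 'a \<Rightarrow> ('a \<Rightarrow> 'a) \<Rightarrow> ('a \<times> 'a) set" where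
  "tree_arcs V r p = (\<Union>x\<in>V - {r}. {(x, p x), (p x, x)})"

definition end_vertices :: "'a set \<Rightarrow> ('a \<times> 'a) set \<Rightarrow> 'a set" where
  "end_vertices V T = {v \<in> V. card (T `` {v}) = 1}"

definition leaf_tree :: "('a \<times> 'a) set \<Rightarrow> 'a set \<Rightarrow> 'a set \<Rightarrow> bool" where
  "leaf_tree E V S \<longleftrightarrow> (\<exists>r p. rooted_tree V r p \<and> tree_arcs V r p \<subseteq> E \<and>
     end_vertices V (tree_arcs V r p) = S)"

abbreviation children :: "'a set \<Rightarrow> 'a \<Rightarrow> ('a \<Rightarrow> 'a) \<Rightarrow> 'a \<Rightarrow> 'a set" where
  "children V r p x \<equiv> {w \<in> V - {r}. p w = x}"

lemma rooted_treeI: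
  fixes h :: "'a \<Rightarrow> nat"
  assumes "finite V" "r \<in> V" "\<And>x. x \<in> V \<Longrightarrow> x \<noteq> r \<Longrightarrow> p x \<in> V \<and> h (p x) < h x"
  shows "rooted_tree V r p"
  unfolding rooted_tree_def using assms by blast

lemma rooted_treeE:
  assumes "rooted_tree V r p"
  obtains h :: "'a \<Rightarrow> nat"
  where "finite V" "r \<in> V" "\<And>x. x \<in> V \<Longrightarrow> x \<noteq> r \<Longrightarrow> p x \<in> V"
    "\<And>x. x \<in> V \<Longrightarrow> x \<noteq> r \<Longrightarrow> h (p x) < h x" "\<And>x. x \<in> V \<Longrightarrow> x \<noteq> r \<Longrightarrow> h r < h x"
proof -
  obtain h :: "'a \<Rightarrow> nat" where h: "\<And>x. x \<in> V \<Longrightarrow> x \<noteq> r \<Longrightarrow> h (p x) < h x"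
    and V: "finite V" "r \<in> V" "\<And>x. x \<in> V \<Longrightarrow> x \<noteq> r \<Longrightarrow> p x \<in> V"
    using assms unfolding rooted_tree_def by blast
  have "h r < h x" if "x \<in> V" "x \<noteq> r" for x
    using that
  proof (induction "h x" arbitrary: x rule: less_induct)
    case less
    show ?case
      using less.hyps[OF h[OF less.prems]] h[OF less.prems] V(3)[OF less.prems]
      by (cases "p x = r") auto
  qed
  then show thesis using that V h by blast
qed

lemma parent_neq: "rooted_tree V r p \<Longrightarrow> x \<in> V \<Longrightarrow> x \<noteq> r \<Longrightarrow> p x \<noteq> x"
  by (metis less_irrefl rooted_treeE)

lemma sym_tree_arcs: "sym (tree_arcs V r p)"
  unfolding tree_arcs_def sym_def by blast

lemma tree_arcs_Image:
  "tree_arcs V r p `` {x} = children V r p x \<union> (if x \<in> V - {r} then {p x} else {})"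
  unfolding tree_arcs_def by auto

lemma card_tree_arcs_Image:
  assumes "rooted_tree V r p" "x \<in> V"
  shows "card (tree_arcs V r p `` {x}) = card (children V r p x) + (if x = r then 0 else 1)"
proof -
  obtain h :: "'a \<Rightarrow> nat" where h: "finite V" "\<And>x. x \<in> V \<Longrightarrow> x \<noteq> r \<Longrightarrow> h (p x) < h x"
    using assms(1) by (rule rooted_treeE) blast
  have "p x \<notin> children V r p x" if "x \<noteq> r"
    using h(2)[of x] h(2)[of "p x"] that assms(2) by auto
  then show ?thesis
    using h(1) assms(2) by (auto simp: tree_arcs_Image)
qed

lemma tree_arcs_subset:
  assumes "rooted_tree V r p"
  shows "tree_arcs V r p \<subseteq> V \<times> V"
  using assms unfolding rooted_tree_def tree_arcs_def by auto

lemma tree_arcs_Image_nonempty: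
  assumes "rooted_tree V r p" "x \<in> V" "2 \<le> card V"
  shows "tree_arcs V r p `` {x} \<noteq> {}"
proof (cases "x = r")
  case True
  obtain h :: "'a \<Rightarrow> nat" where h: "finite V" "r \<in> V" "\<And>x. x \<in> V \<Longrightarrow> x \<noteq> r \<Longrightarrow> p x \<in> V"
    "\<And>x. x \<in> V \<Longrightarrow> x \<noteq> r \<Longrightarrow> h (p x) < h x"
    using assms(1) by (rule rooted_treeE) blast
  have "V - {r} \<noteq> {}"
    using assms(3) card_mono[of "{r}" V] by auto
  then obtain y where y: "y \<in> V - {r}" "\<And>z. z \<in> V - {r} \<Longrightarrow> h y \<le> h z"
    using ex_has_least_nat[of "\<lambda>z. z \<in> V - {r}" _ h] by blast
  have "p y = r"
    using y(2)[of "p y"] y(1) h(3)[of y] h(4)[of y] by force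
  then show ?thesis using y(1) True by (auto simp: tree_arcs_Image)
qed (use assms in \<open>auto simp: tree_arcs_Image\<close>)

text \<open>
  \<open>D\<close> consists of the descendants of \<open>v\<close>. It is described by being closed under parents and children
  away from \<open>u\<close> and \<open>v\<close>; if \<open>v\<close> is a child of \<open>u\<close>, the complement \<open>V - D\<close> satisfies the same
  condition once the tree is rooted at \<open>v\<close>, so that both sides of the edge \<open>uv\<close> can be treated by the
  same lemmas.
\<close>

lemma descendants_exist:
  assumes "rooted_tree V u p" "v \<in> V" "v \<noteq> u"
  obtains D where "D \<subseteq> V" "v \<in> D" "u \<notin> D" "\<And>w. w \<in> V \<Longrightarrow> w \<noteq> u \<Longrightarrow> w \<noteq> v \<Longrightarrow> w \<in> D \<longleftrightarrow> p w \<in> D"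
proof -
  let ?R = "{(x, p x) | x. x \<in> V - {u}}"
  let ?D = "{x \<in> V. (x, v) \<in> ?R\<^sup>*}"
  have pV: "\<And>x. x \<in> V \<Longrightarrow> x \<noteq> u \<Longrightarrow> p x \<in> V" using assms(1) by (auto simp: rooted_tree_def)
  have "u \<notin> ?D"
  proof
    assume "u \<in> ?D"
    then have "(u, v) \<in> ?R\<^sup>*" by (rule CollectE) (elim conjE)
    then show False using assms(3) by (cases rule: converse_rtranclE) auto
  qed
  moreover have "w \<in> ?D \<longleftrightarrow> p w \<in> ?D" if "w \<in> V" "w \<noteq> u" "w \<noteq> v" for w
  proof
    assume "w \<in> ?D"
    then have "(w, v) \<in> ?R\<^sup>*" by (rule CollectE) (elim conjE)
    then have "(p w, v) \<in> ?R\<^sup>*"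
      using that(3) by (cases rule: converse_rtranclE) auto
    then show "p w \<in> ?D" using pV[OF that(1,2)] by (intro CollectI conjI)
  next
    assume "p w \<in> ?D"
    then have "(p w, v) \<in> ?R\<^sup>*" by (rule CollectE) (elim conjE)
    moreover have "(w, p w) \<in> ?R" using that by blast
    ultimately have "(w, v) \<in> ?R\<^sup>*" by (rule converse_rtrancl_into_rtrancl[rotated])
    then show "w \<in> ?D" using that(1) by (intro CollectI conjI)
  qed
  moreover have "?D \<subseteq> V" "v \<in> ?D" using assms(2) by auto
  ultimately show thesis using that[of ?D] by blast
qed

text \<open>
  Moving the root along one edge reverses only that edge. The vertices outside the subtree of the
  new root are now reached through it, so their ranks are raised above its rank.
\<close>

lemma reroot_adjacent:
  assumes "rooted_tree V r p" "u \<in> V" "u \<noteq> r" "p u = r"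
  shows "rooted_tree V u (p(r := u))" "tree_arcs V u (p(r := u)) = tree_arcs V r p"
proof -
  obtain h :: "'a \<Rightarrow> nat" where h: "finite V" "r \<in> V" "\<And>x. x \<in> V \<Longrightarrow> x \<noteq> r \<Longrightarrow> p x \<in> V"
    "\<And>x. x \<in> V \<Longrightarrow> x \<noteq> r \<Longrightarrow> h (p x) < h x"
    using assms(1) by (rule rooted_treeE) blast
  obtain D where D: "D \<subseteq> V" "u \<in> D" "r \<notin> D"
    "\<And>w. w \<in> V \<Longrightarrow> w \<noteq> r \<Longrightarrow> w \<noteq> u \<Longrightarrow> w \<in> D \<longleftrightarrow> p w \<in> D"
    using descendants_exist[OF assms(1-3)] by blast
  let ?h = "\<lambda>x. if x \<in> D then h x else h x + h u + 1"
  show "rooted_tree V u (p(r := u))"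
  proof (rule rooted_treeI[where h = ?h])
    fix x assume x: "x \<in> V" "x \<noteq> u"
    show "(p(r := u)) x \<in> V \<and> ?h ((p(r := u)) x) < ?h x"
    proof (cases "x = r")
      case False
      then show ?thesis using h(3)[OF x(1)] h(4)[OF x(1)] D(4)[OF x(1) _ x(2)] by simp
    qed (use D(2,3) assms(2) in simp)
  qed (use h(1) assms(2) in auto)
  show "tree_arcs V u (p(r := u)) = tree_arcs V r p"
  proof -
    have "V - {u} = insert r (V - {u, r})" "V - {r} = insert u (V - {u, r})"
      using assms(2,3) h(2) by auto
    moreover have "(\<Union>x\<in>V - {u, r}. {(x, (p(r := u)) x), ((p(r := u)) x, x)}) =
        (\<Union>x\<in>V - {u, r}. {(x, p x), (p x, x)})"
      by (rule SUP_cong) auto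
    ultimately show ?thesis
      unfolding tree_arcs_def by (simp only: UN_insert fun_upd_same assms(4)) blast
  qed
qed

lemma reroot:
  assumes "rooted_tree V r p" "u \<in> V"
  shows "\<exists>q. rooted_tree V u q \<and> tree_arcs V u q = tree_arcs V r p"
proof -
  obtain h :: "'a \<Rightarrow> nat" where h: "finite V" "r \<in> V" "\<And>x. x \<in> V \<Longrightarrow> x \<noteq> r \<Longrightarrow> p x \<in> V"
    "\<And>x. x \<in> V \<Longrightarrow> x \<noteq> r \<Longrightarrow> h (p x) < h x"
    using assms(1) by (rule rooted_treeE) blast
  show ?thesis using assms(2)
  proof (induction "h u" arbitrary: u rule: less_induct)
    case less
    show ?case
    proof (cases "u = r")
      case False
      then obtain q where q: "rooted_tree V (p u) q" "tree_arcs V (p u) q = tree_arcs V r p"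
        using less h(3,4) by blast
      have "(u, p u) \<in> tree_arcs V (p u) q"
        unfolding q(2) using False less.prems by (auto simp: tree_arcs_def)
      then have "q u = p u" unfolding tree_arcs_def by auto
      moreover have "u \<noteq> p u" using parent_neq[OF assms(1)] False less.prems by metis
      ultimately show ?thesis
        using reroot_adjacent[OF q(1) less.prems] q(2) by auto
    qed (use assms(1) in blast)
  qed
qed

lemma leaf_tree_edge:
  assumes "sym E" "(x, y) \<in> E" "x \<noteq> y"
  shows "leaf_tree E {x, y} {x, y}"
proof -
  have rt: "rooted_tree {x, y} x (\<lambda>_. x)"
    by (rule rooted_treeI[where h = "\<lambda>z. if z = x then 0 else 1"]) (use assms in auto)
  have ta: "tree_arcs {x, y} x (\<lambda>_. x) = {(x, y), (y, x)}"
    using assms by (auto simp: tree_arcs_def)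
  have "{(x, y), (y, x)} `` {x} = {y}" "{(x, y), (y, x)} `` {y} = {x}" using assms(3) by auto
  then have "end_vertices {x, y} {(x, y), (y, x)} = {x, y}"
    unfolding end_vertices_def by auto
  then show ?thesis
    unfolding leaf_tree_def using rt ta assms by (metis empty_subsetI insert_subset symD)
qed

text \<open>
  The new vertex \<open>w\<close> is a leaf and \<open>x\<close> is none any more: at a leaf \<open>x\<close> this prolongs a path,
  at an inner vertex it adds a pendant vertex.
\<close>

lemma leaf_tree_attach:
  assumes "sym E" "leaf_tree E V S" "2 \<le> card V" "x \<in> V" "w \<notin> V" "(x, w) \<in> E"
  shows "leaf_tree E (insert w V) (insert w (S - {x}))"
proof -
  obtain r p where T: "rooted_tree V r p" "tree_arcs V r p \<subseteq> E" "end_vertices V (tree_arcs V r p) = S"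
    using assms(2) unfolding leaf_tree_def by blast
  obtain h :: "'a \<Rightarrow> nat" where h: "finite V" "r \<in> V" "\<And>x. x \<in> V \<Longrightarrow> x \<noteq> r \<Longrightarrow> p x \<in> V"
    "\<And>x. x \<in> V \<Longrightarrow> x \<noteq> r \<Longrightarrow> h (p x) < h x"
    using T(1) by (rule rooted_treeE) blast
  let ?T = "tree_arcs V r p" and ?p = "p(w := x)" and ?V = "insert w V"
  have "\<And>y. y \<in> V \<Longrightarrow> y \<noteq> r \<Longrightarrow> p y \<noteq> w" using h(3) assms(5) by metis
  then have rt: "rooted_tree ?V r ?p"
    by (intro rooted_treeI[where h = "h(w := h x + 1)"]) (use h assms in auto)
  have ta: "tree_arcs ?V r ?p = ?T \<union> {(w, x), (x, w)}"
  proof -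
    have "?V - {r} = insert w (V - {r})" using h(2) assms(5) by auto
    moreover have "(\<Union>y\<in>V - {r}. {(y, ?p y), (?p y, y)}) = ?T"
      unfolding tree_arcs_def by (rule SUP_cong) (use assms(5) in auto)
    ultimately show ?thesis
      unfolding tree_arcs_def by (simp only: UN_insert fun_upd_same) blast
  qed
  have sub: "?T \<subseteq> V \<times> V" by (rule tree_arcs_subset[OF T(1)])
  have fin: "finite (?T `` {v})" for v
    using sub h(1) by (auto intro: finite_subset[of _ V])
  have iw: "tree_arcs ?V r ?p `` {w} = {x}" using sub assms(4,5) unfolding ta by auto
  have ix: "tree_arcs ?V r ?p `` {x} = insert w (?T `` {x})" using assms(4,5) unfolding ta by auto
  have "w \<notin> ?T `` {x}" using sub assms(5) by auto
  moreover have "card (?T `` {x}) \<noteq> 0"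
    using tree_arcs_Image_nonempty[OF T(1) assms(4,3)] fin by auto
  ultimately have cx: "card (tree_arcs ?V r ?p `` {x}) \<noteq> 1" unfolding ix using fin by auto
  have "tree_arcs ?V r ?p `` {v} = ?T `` {v}" if "v \<noteq> w" "v \<noteq> x" for v
    using that unfolding ta by auto
  then have "end_vertices ?V (tree_arcs ?V r ?p) = insert w (S - {x})"
    unfolding T(3)[symmetric] end_vertices_def using iw cx assms(5) by (auto; metis)
  moreover have "tree_arcs ?V r ?p \<subseteq> E"
    unfolding ta using T(2) assms(1,6) by (auto dest: symD)
  ultimately show ?thesis unfolding leaf_tree_def using rt by blast
qed

lemma leaf_tree_finite: "leaf_tree E V S \<Longrightarrow> finite V"
  by (auto simp: leaf_tree_def rooted_tree_def)

lemma leaf_tree_subset: "leaf_tree E V S \<Longrightarrow> S \<subseteq> V"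
  by (auto simp: leaf_tree_def end_vertices_def)

lemma leaf_tree_pendants:
  assumes "sym E" "finite Z" "leaf_tree E V S" "2 \<le> card V" "c \<in> V - S" "Z \<inter> V = {}" "{c} \<times> Z \<subseteq> E"
  shows "leaf_tree E (V \<union> Z) (S \<union> Z)"
  using assms(2,6,7)
proof (induction Z rule: finite_induct)
  case (insert z Z)
  have fin: "finite (V \<union> Z)" using insert.hyps leaf_tree_finite[OF assms(3)] by simp
  have "2 \<le> card (V \<union> Z)" using assms(4) card_mono[OF fin, of V] by simp
  then have "leaf_tree E (insert z (V \<union> Z)) (insert z ((S \<union> Z) - {c}))"
    using insert.prems insert.hyps assms(5)
    by (intro leaf_tree_attach[OF assms(1) insert.IH]) auto
  moreover have "(S \<union> Z) - {c} = S \<union> Z" using assms(5) insert.prems by auto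
  ultimately show ?case by simp
qed (use assms in simp)

text \<open>
  A path ending in a vertex \<open>e\<close> that is adjacent to everything can be prolonged alternately
  through \<open>Y\<close> and \<open>X\<close>; each step ends again in a vertex of \<open>C\<close>. The vertices of
  \<open>Y\<close> may be pairwise non-adjacent, which is why there must be at least as many in \<open>X\<close>.
\<close>

lemma leaf_tree_grow:
  assumes E: "sym E" and univ: "\<And>c y. c \<in> C \<Longrightarrow> y \<in> V \<Longrightarrow> y \<noteq> c \<Longrightarrow> (c, y) \<in> E"
    and "finite X" "card Y \<le> card X" "finite Y"
    and "leaf_tree E W (insert e F)" "2 \<le> card W" "e \<in> C" "e \<notin> F" "W \<subseteq> V"
    and "X \<subseteq> C" "C \<subseteq> V" "Y \<subseteq> V" "X \<inter> Y = {}" "X \<inter> W = {}" "Y \<inter> W = {}"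
  shows "\<exists>e'\<in>C. e' \<notin> F \<and> leaf_tree E (W \<union> X \<union> Y) (insert e' F)"
  using assms(3-)
proof (induction X arbitrary: Y W e rule: finite_induct)
  case empty
  then show ?case by auto
next
  case (insert x X)
  note [simp] = leaf_tree_finite[OF insert.prems(3)]
  have F: "F \<subseteq> W" using leaf_tree_subset[OF insert.prems(3)] by auto
  show ?case
  proof (cases "Y = {}")
    case True
    have 1: "leaf_tree E (insert x W) (insert x F)"
      using leaf_tree_attach[OF E insert.prems(3,4), of e x] insert.prems univ[of e x]
      leaf_tree_subset[OF insert.prems(3)] by auto
    have "\<exists>e'\<in>C. e' \<notin> F \<and> leaf_tree E (insert x W \<union> X \<union> {}) (insert e' F)"
      by (rule insert.IH[OF _ _ 1]) (use insert.prems insert.hyps F in auto)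
    then show ?thesis using True by simp
  next
    case False
    then obtain y where y: "y \<in> Y" by blast
    have 1: "leaf_tree E (insert y W) (insert y F)"
      using leaf_tree_attach[OF E insert.prems(3,4), of e y] insert.prems univ[of e y] y
      leaf_tree_subset[OF insert.prems(3)] by auto
    have "(x, y) \<in> E" using univ[of x y] insert.prems y by auto
    then have "(y, x) \<in> E" using E by (auto dest: symD)
    moreover have "2 \<le> card (insert y W)" using insert.prems(4) by (simp add: card_insert_if)
    moreover have "x \<notin> insert y W" "insert y F - {y} = F" using insert.prems y F by auto
    ultimately have 2: "leaf_tree E (insert x (insert y W)) (insert x F)"
      using leaf_tree_attach[OF E 1, of y x] by auto
    have "\<exists>e'\<in>C. e' \<notin> F \<and> leaf_tree E (insert x (insert y W) \<union> X \<union> (Y - {y})) (insert e' F)"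
      by (rule insert.IH[OF _ _ 2])
        (use insert.prems insert.hyps F y in \<open>auto simp: card_insert_if\<close>)
    moreover have "insert x (insert y W) \<union> X \<union> (Y - {y}) = W \<union> insert x X \<union> Y" using y by auto
    ultimately show ?thesis by simp
  qed
qed

section \<open>Deleting an edge between vertices of large degree sum\<close>

text \<open>
  Let \<open>T\<close> be rooted at \<open>u\<close> with child \<open>v\<close>, and let \<open>y\<close> lie on the side of \<open>u\<close>, with parent
  \<open>x = p y\<close>. Removing \<open>uv\<close> and \<open>xy\<close> and adding \<open>uy\<close> and \<open>vx\<close> gives again a tree, and each of the four
  vertices loses one edge and gains one. All degrees, and with them the leaves, are preserved.
\<close>

lemma exchange_tree:
  assumes T: "rooted_tree V u p" and v: "v \<in> V" "v \<noteq> u" "p v = u"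
    and D: "v \<in> D" "u \<notin> D" "\<And>w. w \<in> V \<Longrightarrow> w \<noteq> u \<Longrightarrow> w \<noteq> v \<Longrightarrow> w \<in> D \<longleftrightarrow> p w \<in> D"
    and y: "y \<in> V - D" "y \<noteq> u" "p y \<noteq> u"
  defines "q \<equiv> p(y := u, v := p y)"
  shows "rooted_tree V u q" "end_vertices V (tree_arcs V u q) = end_vertices V (tree_arcs V u p)"
proof -
  obtain h :: "'a \<Rightarrow> nat" where h: "finite V" "u \<in> V" "\<And>x. x \<in> V \<Longrightarrow> x \<noteq> u \<Longrightarrow> p x \<in> V"
    "\<And>x. x \<in> V \<Longrightarrow> x \<noteq> u \<Longrightarrow> h (p x) < h x" "\<And>x. x \<in> V \<Longrightarrow> x \<noteq> u \<Longrightarrow> h u < h x"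
    using T by (rule rooted_treeE) blast
  have yv: "y \<noteq> v" using D(1) y(1) by blast
  have py: "p y \<in> V" "p y \<notin> D" using h(3)[of y] D(3)[of y] y yv by auto
  \<comment> \<open>the side of \<open>v\<close> now hangs below \<open>x\<close>\<close>
  let ?h = "\<lambda>w. if w \<in> D then h w + h (p y) + 1 else h w"
  show T': "rooted_tree V u q"
  proof (rule rooted_treeI[where h = ?h])
    fix w assume w: "w \<in> V" "w \<noteq> u"
    consider "w = v" | "w = y" | "w \<noteq> v" "w \<noteq> y" by blast
    then show "q w \<in> V \<and> ?h (q w) < ?h w"
    proof cases
      case 1
      then show ?thesis using py D(1) by (simp add: q_def)
    next
      case 2
      then show ?thesis using yv y D(2) h(2) h(5)[of y] by (simp add: q_def)
    next
      case 3
      then show ?thesis using D(3)[OF w 3(1)] h(3,4)[OF w] by (simp add: q_def)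
    qed
  qed (use h in auto)
  have swap: "card (insert a (A - {b})) = card A" if "a \<notin> A" "b \<in> A" "A \<subseteq> V" for a b and A :: "'a set"
    using that finite_subset[OF that(3) h(1)] by (metis card_insert_disjoint card_Suc_Diff1 finite_Diff Diff_iff)
  have card: "card (children V u q z) = card (children V u p z)" if "z \<in> V" for z
  proof -
    consider "z = u" | "z = p y" | "z \<noteq> u" "z \<noteq> p y" by blast
    then show ?thesis
    proof cases
      case 1
      then have "children V u q z = insert y (children V u p z - {v})"
        using v y yv by (auto simp: q_def)
      then show ?thesis using swap[of y "children V u p z" v] 1 v y by auto
    next
      case 2
      then have "children V u q z = insert v (children V u p z - {y})"
        using v y yv by (auto simp: q_def)
      then show ?thesis using swap[of v "children V u p z" y] 2 v y by auto
    next
      case 3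
      then have "children V u q z = children V u p z"
        using v y yv by (auto simp: q_def)
      then show ?thesis by simp
    qed
  qed
  show "end_vertices V (tree_arcs V u q) = end_vertices V (tree_arcs V u p)"
    unfolding end_vertices_def
    by (rule Collect_cong, rule conj_cong[OF refl])
      (simp only: card_tree_arcs_Image[OF T] card_tree_arcs_Image[OF T'] card)
qed

text \<open>
  If no exchange on the side of \<open>u\<close> is available, the neighbours \<open>y\<close> of \<open>u\<close> on that side and the
  chosen children of the non-leaf neighbours of \<open>v\<close> on that side are different vertices, all
  distinct from \<open>u\<close>. Only leaves of the tree, which have no child, escape the count.
\<close>

lemma no_exchange_bound:
  assumes T: "rooted_tree V u p" and v: "v \<in> V" "v \<noteq> u" "p v = u"
    and D: "v \<in> D" "u \<notin> D" "\<And>w. w \<in> V \<Longrightarrow> w \<noteq> u \<Longrightarrow> w \<noteq> v \<Longrightarrow> w \<in> D \<longleftrightarrow> p w \<in> D"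
    and E: "(u, u) \<notin> E" "(v, u) \<notin> E"
    and no: "\<And>y. y \<in> V - D \<Longrightarrow> y \<noteq> u \<Longrightarrow> (u, y) \<in> E \<Longrightarrow> (v, p y) \<notin> E"
  shows "card (E `` {u} \<inter> (V - D)) + card (E `` {v} \<inter> (V - D) - end_vertices V (tree_arcs V u p))
    < card (V - D)"
proof -
  let ?A = "E `` {u} \<inter> (V - D)" and ?B = "E `` {v} \<inter> (V - D) - end_vertices V (tree_arcs V u p)"
  have fin: "finite V" "u \<in> V" using T by (auto simp: rooted_tree_def)
  have "\<exists>w. w \<in> V - D - {u} \<and> p w = x" if x: "x \<in> ?B" for x
  proof -
    have xu: "x \<noteq> u" "x \<in> V" "x \<notin> D" using x E by auto
    then have "card (children V u p x) \<noteq> 0"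
      using x card_tree_arcs_Image[OF T, of x] by (simp add: end_vertices_def)
    then have "children V u p x \<noteq> {}" by (metis card.empty)
    then obtain w where w: "w \<in> V" "w \<noteq> u" "p w = x" by blast
    then have "w \<notin> D" using D(3)[of w] v xu by auto
    then show ?thesis using w by blast
  qed
  then obtain c where c: "\<And>x. x \<in> ?B \<Longrightarrow> c x \<in> V - D - {u} \<and> p (c x) = x" by metis
  have inj: "inj_on c ?B" by (rule inj_on_inverseI[of _ p]) (use c in blast)
  have disj: "?A \<inter> c ` ?B = {}"
  proof -
    have "c x \<notin> ?A" if "x \<in> ?B" for x
      using c[OF that] no[of "c x"] that by auto
    then show ?thesis by blast
  qed
  have "?A \<subseteq> V - D - {u}" using E(1) by auto
  then have sub: "?A \<union> c ` ?B \<subseteq> V - D - {u}" using c by blast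
  have "card ?A + card ?B = card (?A \<union> c ` ?B)"
    using card_Un_disjoint[OF _ _ disj] fin card_image[OF inj] by simp
  also have "\<dots> \<le> card (V - D - {u})" using sub fin by (intro card_mono) auto
  also have "\<dots> < card (V - D)" using fin D(2) by (intro psubset_card_mono) auto
  finally show ?thesis .
qed

text \<open>
  This is the closure step of Bondy and Chvatal for spanning trees with a prescribed leaf set. If the tree
  uses \<open>uv\<close> and no exchange is possible on either side of that edge, adding the two counts
  gives \<open>d(u) + d(v) \<le> |V| - 2 + |S|\<close>, since the leaves lost in the two counts are disjoint
  subsets of \<open>S\<close>.
\<close>

lemma leaf_tree_remove_edge:
  assumes E: "sym E" "irrefl E" "E \<subseteq> V \<times> V" and uv: "u \<in> V" "v \<in> V" "u \<noteq> v" "(u, v) \<notin> E"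
    and deg: "card V + card S \<le> card (E `` {u}) + card (E `` {v}) + 1"
    and tree: "leaf_tree (insert (u, v) (insert (v, u) E)) V S"
  shows "leaf_tree E V S"
proof (rule ccontr)
  assume not: "\<not> leaf_tree E V S"
  let ?E = "insert (u, v) (insert (v, u) E)"
  obtain r p' where T0: "rooted_tree V r p'" "tree_arcs V r p' \<subseteq> ?E"
    "end_vertices V (tree_arcs V r p') = S"
    using tree unfolding leaf_tree_def by blast
  obtain p where T: "rooted_tree V u p" and arcs: "tree_arcs V u p = tree_arcs V r p'"
    using reroot[OF T0(1) uv(1)] by blast
  have "\<not> tree_arcs V u p \<subseteq> E"
    using not T T0(3) arcs unfolding leaf_tree_def by metis
  then have "(u, v) \<in> tree_arcs V u p \<or> (v, u) \<in> tree_arcs V u p"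
    using T0(2) arcs by blast
  then have pv: "p v = u" unfolding tree_arcs_def by auto
  have fin: "finite V" using T by (auto simp: rooted_tree_def)
  have noself: "(w, w) \<notin> E" for w using E(2) by (auto simp: irrefl_def)
  have nvu: "(v, u) \<notin> E" using uv(4) E(1) by (auto dest: symD)
  obtain D where D: "D \<subseteq> V" "v \<in> D" "u \<notin> D"
    "\<And>w. w \<in> V \<Longrightarrow> w \<noteq> u \<Longrightarrow> w \<noteq> v \<Longrightarrow> w \<in> D \<longleftrightarrow> p w \<in> D"
    using descendants_exist[OF T uv(2) uv(3)[symmetric]] by blast
  obtain q where q: "rooted_tree V v q" "tree_arcs V v q = tree_arcs V r p'" "q u = v"
    "\<And>w. w \<noteq> u \<Longrightarrow> q w = p w"
    using reroot_adjacent[OF T uv(2) uv(3)[symmetric] pv] arcs by (metis fun_upd_other fun_upd_same)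
  have exch: "\<not> ((a, y) \<in> E \<and> (b, f y) \<in> E)"
    if "rooted_tree V a f" "tree_arcs V a f = tree_arcs V r p'" "b \<in> V" "b \<noteq> a" "f b = a"
      "b \<in> C" "a \<notin> C" "\<And>w. w \<in> V \<Longrightarrow> w \<noteq> a \<Longrightarrow> w \<noteq> b \<Longrightarrow> w \<in> C \<longleftrightarrow> f w \<in> C"
      "y \<in> V - C" "y \<noteq> a" "{a, b} = {u, v}" for a b f C y
  proof
    assume ab: "(a, y) \<in> E \<and> (b, f y) \<in> E"
    have "f y \<noteq> a" using ab nvu uv(4) that(4,11) by (auto simp: doubleton_eq_iff)
    note T' = exchange_tree[OF that(1,3-10) this]
    have "(w, f w) \<in> ?E" if "w \<in> V" "w \<noteq> a" for w
    proof -
      have "(w, f w) \<in> tree_arcs V a f" unfolding tree_arcs_def using that by blast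
      then show ?thesis using T0(2) \<open>tree_arcs V a f = tree_arcs V r p'\<close> by blast
    qed
    then have "(w, f w) \<in> E" if "w \<in> V" "w \<noteq> a" "w \<noteq> b" for w
      using that \<open>{a, b} = {u, v}\<close> by (auto simp: doubleton_eq_iff)
    moreover have "(y, a) \<in> E" using ab E(1) by (auto dest: symD)
    ultimately have "(w, (f(y := a, b := f y)) w) \<in> E" if "w \<in> V - {a}" for w
      using that ab by auto
    then have "tree_arcs V a (f(y := a, b := f y)) \<subseteq> E"
      unfolding tree_arcs_def using E(1) by (auto dest: symD simp del: fun_upd_apply)
    then show False
      using not T' T0(3) that(2) unfolding leaf_tree_def by metis
  qed
  have "card (E `` {u} \<inter> (V - D)) + card (E `` {v} \<inter> (V - D) - S) < card (V - D)"
    using no_exchange_bound[OF T uv(2) uv(3)[symmetric] pv D(2-4) noself nvu]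
      exch[OF T arcs uv(2) uv(3)[symmetric] pv D(2-4)] arcs T0(3) by simp
  moreover
  have D2: "w \<in> V - D \<longleftrightarrow> q w \<in> V - D" if "w \<in> V" "w \<noteq> v" "w \<noteq> u" for w
    using D(4)[of w] that T q(4)[of w] by (auto simp: rooted_tree_def)
  have D3: "u \<in> V - D" "v \<notin> V - D" using D(2,3) uv(1) by auto
  have "card (E `` {v} \<inter> (V - (V - D))) + card (E `` {u} \<inter> (V - (V - D)) - S) < card (V - (V - D))"
    using no_exchange_bound[OF q(1) uv(1,3) q(3) D3 D2 noself uv(4)]
      exch[OF q(1,2) uv(1,3) q(3) D3 D2] q(2) T0(3) by (simp add: insert_commute)
  moreover have "V - (V - D) = D" using D(1) by auto
  moreover have split: "card (E `` {w}) = card (E `` {w} \<inter> (V - D)) + card (E `` {w} \<inter> D)" for w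
  proof -
    have "E `` {w} = (E `` {w} \<inter> (V - D)) \<union> (E `` {w} \<inter> D)" using E(3) D(1) by auto
    moreover have "card ((E `` {w} \<inter> (V - D)) \<union> (E `` {w} \<inter> D)) =
      card (E `` {w} \<inter> (V - D)) + card (E `` {w} \<inter> D)"
      by (rule card_Un_disjoint) (use fin D(1) finite_subset in auto)
    ultimately show ?thesis by simp
  qed
  moreover have "card X \<le> card (X - S) + card (X \<inter> S)" for X
    by (metis Int_Diff_Un Un_commute card_Un_le)
  then have "card (E `` {v} \<inter> (V - D)) \<le> card (E `` {v} \<inter> (V - D) - S) + card ((V - D) \<inter> S)"
    "card (E `` {u} \<inter> D) \<le> card (E `` {u} \<inter> D - S) + card (D \<inter> S)"
    using card_mono[of "(V - D) \<inter> S" "E `` {v} \<inter> (V - D) \<inter> S"]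
      card_mono[of "D \<inter> S" "E `` {u} \<inter> D \<inter> S"] fin finite_subset[OF D(1)]
    by (fastforce intro: order_trans)+
  moreover have "card V = card (V - D) + card D"
    using card_Diff_subset[of D V] card_mono[OF fin D(1)] fin D(1) finite_subset[OF D(1)] by simp
  moreover have "card S = card ((V - D) \<inter> S) + card (D \<inter> S)"
  proof -
    have "S \<subseteq> V" using T0(3) by (auto simp: end_vertices_def)
    then have "S = ((V - D) \<inter> S) \<union> (D \<inter> S)" using D(1) by auto
    moreover have "card (((V - D) \<inter> S) \<union> (D \<inter> S)) = card ((V - D) \<inter> S) + card (D \<inter> S)"
      by (rule card_Un_disjoint) (use fin finite_subset[OF D(1)] in auto)
    ultimately show ?thesis by simp
  qed
  ultimately show False using deg split[of u] split[of v] by simp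
qed

section \<open>Graphs with many universal vertices\<close>

text \<open>
  Once the vertices outside \<open>S\<close> and a few leaves are in place, the rest of \<open>S\<close> is hung on one inner
  vertex that is adjacent to everything.
\<close>

lemma leaf_tree_complete_leaves:
  assumes E: "sym E" and univ: "\<And>c y. c \<in> C \<Longrightarrow> y \<in> V \<Longrightarrow> y \<noteq> c \<Longrightarrow> (c, y) \<in> E"
    and "finite V" "S \<subseteq> V" "F \<subseteq> S" "leaf_tree E (V - S \<union> F) F" "2 \<le> card F" "c \<in> C - S" "c \<in> V"
  shows "leaf_tree E V S"
proof -
  have "2 \<le> card (V - S \<union> F)"
    using assms(3,4,5,7) card_mono[of "V - S \<union> F" F] finite_subset[of _ V] by fastforce
  then have "leaf_tree E (V - S \<union> F \<union> (S - F)) (F \<union> (S - F))"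
    using assms by (intro leaf_tree_pendants[OF E _ assms(6), of _ c]) (auto intro: finite_subset univ)
  moreover have "V - S \<union> F \<union> (S - F) = V" "F \<union> (S - F) = S" using assms(4,5) by auto
  ultimately show ?thesis by simp
qed

lemma ex_other_element: "finite S \<Longrightarrow> 2 \<le> card S \<Longrightarrow> a \<in> S \<Longrightarrow> \<exists>b\<in>S. b \<noteq> a"
proof (rule ccontr)
  assume "finite S" "2 \<le> card S" "\<not> (\<exists>b\<in>S. b \<noteq> a)"
  then show False using card_mono[of "{a}" S] by auto
qed

text \<open>
  The inner vertices form a path that alternates between \<open>C\<close> and \<open>L\<close> until \<open>L\<close> is used up; it begins and ends in
  \<open>C\<close>, so arbitrary elements of \<open>S\<close> can serve as its two end leaves.
\<close>

lemma leaf_tree_few_inner: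
  assumes E: "sym E" and univ: "\<And>c y. c \<in> C \<Longrightarrow> y \<in> V \<Longrightarrow> y \<noteq> c \<Longrightarrow> (c, y) \<in> E"
    and V: "finite V" "C \<union> L = V" "C \<inter> L = {}" and S: "S \<subseteq> V" "2 \<le> card S"
    and less: "card (L - S) < card (C - S)"
  shows "leaf_tree E V S"
proof -
  have [simp]: "finite C" "finite L" "finite S" using V S finite_subset by auto
  obtain x1 where x1: "x1 \<in> C - S" using less by (metis card.empty ex_in_conv not_less_zero)
  obtain s0 where s0: "s0 \<in> S" using S(2) by fastforce
  obtain s1 where s1: "s1 \<in> S" "s1 \<noteq> s0" using ex_other_element[OF _ S(2) s0] by auto
  have "leaf_tree E {x1, s0} {x1, s0}"
    using x1 s0 S V by (intro leaf_tree_edge[OF E] univ) auto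
  moreover have "x1 \<noteq> s0" using x1 s0 by auto
  ultimately have "\<exists>e'\<in>C. e' \<notin> {s0} \<and> leaf_tree E ({x1, s0} \<union> (C - S - {x1}) \<union> (L - S)) (insert e' {s0})"
    using x1 s0 S V less
    by (intro leaf_tree_grow[OF E univ, of C V _ _ _ x1]) (auto simp: card_Diff_singleton)
  then obtain e where e: "e \<in> C" "e \<noteq> s0"
    "leaf_tree E ({x1, s0} \<union> (C - S - {x1}) \<union> (L - S)) {e, s0}" by auto
  have W: "{x1, s0} \<union> (C - S - {x1}) \<union> (L - S) = insert s0 (V - S)" using x1 V by auto
  have "e \<in> insert s0 (V - S)" using leaf_tree_subset[OF e(3)] unfolding W by auto
  moreover have "2 \<le> card (insert s0 (V - S))"
    using card_mono[of "insert s0 (V - S)" "{s0, x1}"] x1 \<open>x1 \<noteq> s0\<close> V by auto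
  ultimately have "leaf_tree E (insert s1 (insert s0 (V - S))) (insert s1 ({e, s0} - {e}))"
    using e s0 s1 S univ[of e s1] by (intro leaf_tree_attach[OF E e(3)[unfolded W]]) auto
  moreover have "insert s1 (insert s0 (V - S)) = V - S \<union> {s0, s1}" "insert s1 ({e, s0} - {e}) = {s0, s1}"
    using e by auto
  ultimately show ?thesis
    using x1 s0 s1 V S by (intro leaf_tree_complete_leaves[OF E univ, of C V _ "{s0, s1}" x1]) auto
qed

text \<open>
  With as many vertices of \<open>L\<close> as of \<open>C\<close>, the path of inner vertices has one end in \<open>L\<close>, and the
  leaf \<open>s0\<close> attached there has to come from \<open>C\<close>. The other end \<open>e\<close> is left open for
  continuation.
\<close>

lemma leaf_tree_alternating:
  assumes E: "sym E" and univ: "\<And>c y. c \<in> C \<Longrightarrow> y \<in> V \<Longrightarrow> y \<noteq> c \<Longrightarrow> (c, y) \<in> E"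
    and V: "finite V" "C \<union> L = V" "C \<inter> L = {}" and S: "S \<subseteq> V" "s0 \<in> S \<inter> C"
    and Y: "Y \<subseteq> L - S" "card Y = card (C - S)" and ne: "C - S \<noteq> {}"
  obtains e where "e \<in> C" "e \<notin> S" "leaf_tree E (insert s0 ((C - S) \<union> Y)) {e, s0}"
    "2 \<le> card (insert s0 ((C - S) \<union> Y))"
proof -
  have fin [simp]: "finite C" "finite L" "finite S" "finite Y"
    using V S(1) Y(1) finite_subset[of S V] finite_subset[of Y L] by auto
  obtain x1 where x1: "x1 \<in> C - S" using ne by blast
  have "Y \<noteq> {}" using Y(2) x1 by fastforce
  then obtain y0 where y0: "y0 \<in> Y" by blast
  have neq: "x1 \<noteq> s0" "x1 \<noteq> y0" "s0 \<noteq> y0" using x1 y0 Y S V by auto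
  have 1: "leaf_tree E {s0, y0} {s0, y0}"
    using y0 Y S V by (intro leaf_tree_edge[OF E] univ) auto
  have yx: "(y0, x1) \<in> E" using univ[of x1 y0] x1 y0 Y(1) V E by (auto dest: symD)
  have "leaf_tree E (insert x1 {s0, y0}) (insert x1 ({s0, y0} - {y0}))"
    using y0 Y S V x1 yx neq by (intro leaf_tree_attach[OF E 1]) auto
  moreover have "{s0, y0} - {y0} = {s0}" using y0 Y S V by auto
  ultimately have 2: "leaf_tree E {x1, s0, y0} {x1, s0}" by simp
  have "\<exists>e'\<in>C. e' \<notin> {s0} \<and> leaf_tree E ({x1, s0, y0} \<union> (C - S - {x1}) \<union> (Y - {y0})) (insert e' {s0})"
    using x1 y0 Y S V 2 neq
    by (intro leaf_tree_grow[OF E univ, of C V _ _ _ x1]) (auto simp: card_Diff_singleton)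
  then obtain e where e: "e \<in> C" "e \<noteq> s0"
    "leaf_tree E ({x1, s0, y0} \<union> (C - S - {x1}) \<union> (Y - {y0})) {e, s0}" by auto
  have W: "{x1, s0, y0} \<union> (C - S - {x1}) \<union> (Y - {y0}) = insert s0 ((C - S) \<union> Y)"
    using x1 y0 by auto
  have "e \<in> insert s0 ((C - S) \<union> Y)" using leaf_tree_subset[OF e(3)] unfolding W by auto
  then have "e \<notin> S" using e(2) Y(1) by auto
  moreover have "2 \<le> card (insert s0 ((C - S) \<union> Y))"
    using card_mono[of "insert s0 ((C - S) \<union> Y)" "{s0, x1}"] neq x1 by auto
  ultimately show thesis using that e W by simp
qed

lemma leaf_tree_balanced_inner:
  assumes E: "sym E" and univ: "\<And>c y. c \<in> C \<Longrightarrow> y \<in> V \<Longrightarrow> y \<noteq> c \<Longrightarrow> (c, y) \<in> E"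
    and V: "finite V" "C \<union> L = V" "C \<inter> L = {}" and S: "S \<subseteq> V" "2 \<le> card S" "S \<inter> C \<noteq> {}"
    and eq: "card (L - S) = card (C - S)" and ne: "C - S \<noteq> {}"
  shows "leaf_tree E V S"
proof -
  have fin [simp]: "finite S" using V S finite_subset by auto
  obtain s0 where s0: "s0 \<in> S \<inter> C" using S(3) by blast
  obtain s1 where s1: "s1 \<in> S" "s1 \<noteq> s0" using ex_other_element[of S s0] S(2) s0 by auto
  obtain e where e: "e \<in> C" "e \<notin> S" "leaf_tree E (insert s0 ((C - S) \<union> (L - S))) {e, s0}"
    "2 \<le> card (insert s0 ((C - S) \<union> (L - S)))"
    using leaf_tree_alternating[OF E univ V S(1) s0 order_refl eq ne] by blast
  have "leaf_tree E (insert s1 (insert s0 ((C - S) \<union> (L - S)))) (insert s1 ({e, s0} - {e}))"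
    using e s0 s1 S V univ[of e s1] by (intro leaf_tree_attach[OF E e(3)]) auto
  moreover have "insert s1 (insert s0 ((C - S) \<union> (L - S))) = V - S \<union> {s0, s1}"
    "insert s1 ({e, s0} - {e}) = {s0, s1}"
    using e s0 V by auto
  ultimately show ?thesis
    using e s0 s1 V S by (intro leaf_tree_complete_leaves[OF E univ, of C V _ "{s0, s1}" e]) auto
qed

text \<open>
  Two inner vertices of \<open>L\<close> are left over by the alternating path. One of them prolongs the path
  at its open end, the other becomes the start of a third branch. The inner vertices of \<open>L\<close> at the
  three tips each need a leaf from \<open>C\<close>, and this is where \<open>3 \<le> |S|\<close> enters.
\<close>

lemma leaf_tree_two_more_inner:
  assumes E: "sym E" and univ: "\<And>c y. c \<in> C \<Longrightarrow> y \<in> V \<Longrightarrow> y \<noteq> c \<Longrightarrow> (c, y) \<in> E"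
    and V: "finite V" "C \<union> L = V" "C \<inter> L = {}" and S: "S \<subseteq> C" "3 \<le> card S"
    and eq: "card L = card (C - S) + 2" and ne: "C - S \<noteq> {}"
  shows "leaf_tree E V S"
proof -
  have fin [simp]: "finite S" "finite L" "finite V" using V S finite_subset by auto
  obtain z z' where z: "z \<in> L" "z' \<in> L" "z \<noteq> z'"
    using eq ex_other_element[of L] by (metis fin(2) add_2_eq_Suc' card.empty ex_in_conv le_add2 nat.distinct(1))
  obtain s0 s1 s2 where s: "s0 \<in> S" "s1 \<in> S" "s2 \<in> S" "s0 \<noteq> s1" "s0 \<noteq> s2" "s1 \<noteq> s2"
  proof -
    obtain T where "T \<subseteq> S" "card T = 3" using S(2) by (meson obtain_subset_with_card_n)
    then show thesis using that by (auto simp: card_3_iff)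
  qed
  let ?Y = "L - {z, z'}"
  have Y: "?Y \<subseteq> L - S" "card ?Y = card (C - S)"
    using S V z eq by (auto simp: card_Diff_subset)
  let ?W = "insert s0 ((C - S) \<union> ?Y)"
  obtain e where e: "e \<in> C" "e \<notin> S" "leaf_tree E ?W {e, s0}" "2 \<le> card ?W"
    using leaf_tree_alternating[OF E univ V _ _ Y ne, of s0] s(1) S V by blast
  obtain x1 where x1: "x1 \<in> C - S" using ne by blast
  have eW: "e \<in> ?W" using leaf_tree_subset[OF e(3)] by auto
  have "leaf_tree E (insert z ?W) (insert z ({e, s0} - {e}))"
    using e eW s S V z univ[of e z] by (intro leaf_tree_attach[OF E e(3)]) auto
  moreover have "insert z ({e, s0} - {e}) = {z, s0}" using e s by auto
  ultimately have 1: "leaf_tree E (insert z ?W) {z, s0}" by simp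
  have c1: "2 \<le> card (insert z ?W)" by (rule order_trans[OF e(4) card_insert_le])
  have zs: "(z, s1) \<in> E" "(z', s2) \<in> E"
    using univ[of s1 z] univ[of s2 z'] z s S V E by (auto dest: symD)
  have "leaf_tree E (insert s1 (insert z ?W)) (insert s1 ({z, s0} - {z}))"
    using s S V z zs by (intro leaf_tree_attach[OF E 1 c1]) auto
  moreover have "insert s1 ({z, s0} - {z}) = {s0, s1}" using z s S V by auto
  ultimately have 2: "leaf_tree E (insert s1 (insert z ?W)) {s0, s1}" by simp
  have c2: "2 \<le> card (insert s1 (insert z ?W))" by (rule order_trans[OF c1 card_insert_le])
  have "leaf_tree E (insert z' (insert s1 (insert z ?W))) (insert z' ({s0, s1} - {x1}))"
    using s S V z x1 univ[of x1 z'] by (intro leaf_tree_attach[OF E 2 c2]) auto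
  moreover have "{s0, s1} - {x1} = {s0, s1}" using x1 s by auto
  ultimately have 3: "leaf_tree E (insert z' (insert s1 (insert z ?W))) {z', s0, s1}" by simp
  have c3: "2 \<le> card (insert z' (insert s1 (insert z ?W)))" by (rule order_trans[OF c2 card_insert_le])
  have "leaf_tree E (insert s2 (insert z' (insert s1 (insert z ?W)))) (insert s2 ({z', s0, s1} - {z'}))"
    using s S V z zs by (intro leaf_tree_attach[OF E 3 c3]) auto
  moreover have "insert s2 ({z', s0, s1} - {z'}) = {s0, s1, s2}" using z s S V by auto
  moreover have "insert s2 (insert z' (insert s1 (insert z ?W))) = V - S \<union> {s0, s1, s2}"
    using z s S V by auto
  ultimately show ?thesis
    using e s V S by (intro leaf_tree_complete_leaves[OF E univ, of C V _ "{s0, s1, s2}" e]) auto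
qed

text \<open>
  Removing \<open>S\<close> leaves two vertices more in \<open>L\<close> than in \<open>C\<close> if \<open>S \<subseteq> C\<close>, and each element of
  \<open>S \<inter> L\<close> shifts this difference by two in favour of \<open>C\<close>. The three constructions above cover the
  resulting cases.
\<close>

lemma leaf_tree_universal_part:
  assumes E: "sym E" and univ: "\<And>c y. c \<in> C \<Longrightarrow> y \<in> V \<Longrightarrow> y \<noteq> c \<Longrightarrow> (c, y) \<in> E"
    and V: "finite V" "C \<union> L = V" "C \<inter> L = {}" and S: "S \<subseteq> V" "3 \<le> card S"
    and card: "card C + 2 = card L + card S" "3 \<le> card L"
  shows "leaf_tree E V S"
proof -
  have fin [simp]: "finite S" "finite L" "finite C" using V S finite_subset by auto
  have 1: "card C = card (S \<inter> C) + card (C - S)" "card L = card (S \<inter> L) + card (L - S)"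
    using card_Int_Diff[of C S] card_Int_Diff[of L S] by (simp_all add: Int_commute)
  have "S = (S \<inter> C) \<union> (S \<inter> L)" using S V by auto
  moreover have "card ((S \<inter> C) \<union> (S \<inter> L)) = card (S \<inter> C) + card (S \<inter> L)"
    by (rule card_Un_disjoint) (use V in auto)
  ultimately have 2: "card S = card (S \<inter> C) + card (S \<inter> L)" by simp
  consider "card (S \<inter> L) = 0" | "card (S \<inter> L) = 1" | "2 \<le> card (S \<inter> L)" by linarith
  then show ?thesis
  proof cases
    case 1
    then have "S \<inter> L = {}" by simp
    then have "S \<subseteq> C" "L - S = L" using S V by auto
    moreover have eq: "card L = card (C - S) + 2" using \<open>L - S = L\<close> 1 2 card \<open>card C = _\<close> by simp
    moreover have "C - S \<noteq> {}"
    proof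
      assume "C - S = {}"
      then have "card (C - S) = 0" by simp
      then show False using eq card(2) by linarith
    qed
    ultimately show ?thesis
      by (intro leaf_tree_two_more_inner[OF E univ V]) (use S in auto)
  next
    case 2
    show ?thesis
    proof (rule leaf_tree_balanced_inner[OF E univ V S(1)])
      show "card (L - S) = card (C - S)" using 1 2 \<open>card S = _\<close> card by linarith
      then have "card (C - S) \<noteq> 0" using 1(2) 2 card(2) by linarith
      then show "C - S \<noteq> {}" by (metis card.empty)
      have "card (S \<inter> C) \<noteq> 0" using 2 \<open>card S = _\<close> S(2) by linarith
      then show "S \<inter> C \<noteq> {}" by (metis card.empty)
    qed (use S in auto)
  next
    case 3
    show ?thesis
      by (rule leaf_tree_few_inner[OF E univ V S(1)])
        (use 1 2 3 card S in linarith)+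
  qed
qed

section \<open>From parent functions to undirected spanning trees\<close>

lemma degree_eq_card_Image: "degree G v = card (parcs G `` {v})"
proof -
  have "out_arcs (with_proj G) v = Pair v ` (parcs G `` {v})"
    by (auto simp: out_arcs_def)
  then show ?thesis by (simp add: out_degree_def card_image inj_on_def)
qed

lemma rooted_tree_root_connected:
  assumes "rooted_tree V r p" "x \<in> V"
  shows "(x, r) \<in> rtrancl_on V (tree_arcs V r p)"
proof -
  obtain h :: "'a \<Rightarrow> nat" where h: "finite V" "r \<in> V" "\<And>x. x \<in> V \<Longrightarrow> x \<noteq> r \<Longrightarrow> p x \<in> V"
    "\<And>x. x \<in> V \<Longrightarrow> x \<noteq> r \<Longrightarrow> h (p x) < h x"
    using assms(1) by (rule rooted_treeE) blast
  show ?thesis using assms(2)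
  proof (induction "h x" arbitrary: x rule: less_induct)
    case less
    show ?case
    proof (cases "x = r")
      case True
      then show ?thesis using less.prems by (simp add: rtrancl_on.rtrancl_on_refl)
    next
      case False
      have "(x, p x) \<in> tree_arcs V r p" unfolding tree_arcs_def using less.prems False by blast
      moreover have "(p x, r) \<in> rtrancl_on V (tree_arcs V r p)"
        using less.hyps h(3,4) less.prems False by blast
      ultimately show ?thesis using converse_rtrancl_on_into_rtrancl_on less.prems by metis
    qed
  qed
qed

lemma pcas_consecutive:
  assumes "pcas u es v" "Suc j < length es"
  shows "snd (es ! j) = fst (es ! Suc j)"
  using assms
proof (induction es arbitrary: u j)
  case (Cons e es)
  then show ?case by (cases j) (auto simp: nth_Cons' neq_Nil_conv elim: pcas.elims)
qed simp

lemma pcas_ends: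
  assumes "pcas u es v" "es \<noteq> []"
  shows "fst (hd es) = u" "snd (last es) = v"
  using assms by (induction es arbitrary: u) (auto split: if_splits)

lemma pcas_closed_nth:
  assumes "pcas u es u" "j < length es"
  shows "snd (es ! j) = fst (es ! (Suc j mod length es))"
proof (cases "Suc j < length es")
  case False
  then have "j = length es - 1" "es \<noteq> []" using assms(2) by auto
  then show ?thesis
    using pcas_ends[OF assms(1)] by (simp add: last_conv_nth hd_conv_nth)
qed (use pcas_consecutive[OF assms(1)] in simp)

text \<open>
  At a vertex of maximal rank on a cycle both neighbours have smaller or equal rank, so both are its parent;
  on a cycle of length at least three the two neighbours are different.
\<close>

lemma rooted_tree_no_long_cycle:
  assumes T: "rooted_tree V r p" and cyc: "pre_digraph.cycle (with_proj \<lparr>pverts = V, parcs = tree_arcs V r p\<rparr>) es"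
  shows "length es < 3"
proof (rule ccontr)
  assume "\<not> length es < 3"
  then have m: "3 \<le> length es" by simp
  obtain h :: "'a \<Rightarrow> nat" where h: "finite V" "r \<in> V" "\<And>x. x \<in> V \<Longrightarrow> x \<noteq> r \<Longrightarrow> p x \<in> V"
    "\<And>x. x \<in> V \<Longrightarrow> x \<noteq> r \<Longrightarrow> h (p x) < h x"
    using T by (rule rooted_treeE) blast
  let ?G = "\<lparr>pverts = V, parcs = tree_arcs V r p\<rparr>" and ?m = "length es"
  obtain u where u: "pcas u es u" "set es \<subseteq> tree_arcs V r p" "distinct (tl (pawalk_verts u es))"
    using cyc by (auto simp: pre_digraph.cycle_def pre_digraph.awalk_def cas_with_proj_eq
        awalk_verts_with_proj_eq)
  have "pawalk_verts u es = fst (hd es) # map snd es"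
    using pre_digraph.awalk_verts_conv'[of "with_proj ?G" u es u] u(1) m
    by (auto simp: cas_with_proj_eq awalk_verts_with_proj_eq)
  then have dist: "distinct (map snd es)" using u(3) by simp
  have "Max (h ` snd ` set es) \<in> h ` snd ` set es" using m by (intro Max_in) auto
  then obtain j where j: "j < ?m" "h (snd (es ! j)) = Max (h ` snd ` set es)"
    by (auto simp: in_set_conv_nth)
  have max: "h (snd (es ! i)) \<le> h (snd (es ! j))" if "i < ?m" for i
    unfolding j(2) using that by (intro Max_ge) auto
  let ?x = "snd (es ! j)" and ?i = "if j = 0 then ?m - 1 else j - 1" and ?k = "Suc j mod ?m"
  have ik: "?i < ?m" "?k < ?m" using m j(1) by (auto intro!: mod_less_divisor simp del: mod_less_divisor)
  have "Suc ?i mod ?m = j" using j(1) m by auto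
  then have i: "fst (es ! j) = snd (es ! ?i)" using pcas_closed_nth[OF u(1) ik(1)] by simp
  have k: "fst (es ! ?k) = ?x" using pcas_closed_nth[OF u(1) j(1)] by simp
  have parent: "y = p ?x" if "(?x, y) \<in> tree_arcs V r p" "h y \<le> h ?x" for y
  proof (rule ccontr)
    assume "y \<noteq> p ?x"
    then have "y \<in> V" "y \<noteq> r" "p y = ?x" using that(1) unfolding tree_arcs_def by auto
    then show False using h(4)[of y] that(2) by simp
  qed
  have "(fst (es ! j), ?x) \<in> tree_arcs V r p" using subsetD[OF u(2) nth_mem[OF j(1)]] by simp
  then have "(?x, snd (es ! ?i)) \<in> tree_arcs V r p"
    using sym_tree_arcs i by (metis symD)
  then have 1: "snd (es ! ?i) = p ?x" using parent max[OF ik(1)] by blast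
  have "(fst (es ! ?k), snd (es ! ?k)) \<in> tree_arcs V r p" using subsetD[OF u(2) nth_mem[OF ik(2)]] by simp
  then have "snd (es ! ?k) = p ?x" using parent max[OF ik(2)] k by metis
  then have "map snd es ! ?i = map snd es ! ?k" using 1 ik by (simp only: nth_map)
  then have "?i = ?k" using nth_eq_iff_index_eq[OF dist] ik by (simp only: length_map)
  moreover have "?k = (if Suc j = ?m then 0 else Suc j)" using j(1) by simp
  ultimately show False using m j(1) by (auto split: if_splits)
qed

lemma undirected_spanning_treeI:
  assumes G: "pair_graph G" and tree: "leaf_tree (parcs G) (pverts G) S"
  shows "\<exists>T. undirected_spanning_tree T G \<and> leaves T = S"
proof -
  let ?V = "pverts G"
  obtain r p where T: "rooted_tree ?V r p" "tree_arcs ?V r p \<subseteq> parcs G"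
    "end_vertices ?V (tree_arcs ?V r p) = S"
    using tree unfolding leaf_tree_def by blast
  let ?T = "\<lparr>pverts = ?V, parcs = tree_arcs ?V r p\<rparr>"
  have pg: "pair_graph ?T"
  proof (rule pair_graphI)
    show "irrefl (parcs ?T)"
      using parent_neq[OF T(1)] by (fastforce simp: irrefl_def tree_arcs_def)
  qed (use T(1) tree_arcs_subset[OF T(1)] sym_tree_arcs in \<open>auto simp: rooted_tree_def\<close>)
  interpret T: pair_graph ?T by fact
  interpret G: pair_graph G by fact
  have sym: "(tree_arcs ?V r p)\<^sup>s = tree_arcs ?V r p"
    using sym_tree_arcs[of ?V r p] by (auto simp: symcl_def dest: symD)
  have conn: "Digraph_Component.connected (with_proj ?T)"
    unfolding connected_conv
  proof (intro conjI ballI)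
    show "verts (with_proj ?T) \<noteq> {}" using T(1) by (auto simp: rooted_tree_def)
  next
    fix x y assume "x \<in> verts (with_proj ?T)" "y \<in> verts (with_proj ?T)"
    then have "x \<in> ?V" "y \<in> ?V" by auto
    note xr = rooted_tree_root_connected[OF T(1) this(1)] rooted_tree_root_connected[OF T(1) this(2)]
    have "(r, y) \<in> rtrancl_on ?V (tree_arcs ?V r p)"
      using xr(2) rtrancl_on_sym[OF sym_tree_arcs] by (metis symD)
    then show "(x, y) \<in> rtrancl_on (verts (with_proj ?T)) ((arcs_ends (with_proj ?T))\<^sup>s)"
      using rtrancl_on_trans[OF xr(1)] sym by simp
  qed
  have "undirected_tree ?T"
    unfolding undirected_tree_def using pg conn rooted_tree_no_long_cycle[OF T(1)]
    by (meson not_le)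
  moreover have "spanning (with_proj ?T) (with_proj G)"
    unfolding spanning_def subgraph_def compatible_def
    using T(2) T.wf_digraph_axioms G.wf_digraph_axioms by simp
  moreover have "leaves ?T = S"
    using T(3) by (simp add: leaves_def end_vertices_def degree_eq_card_Image)
  ultimately show ?thesis unfolding undirected_spanning_tree_def by blast
qed

section \<open>Saturated graphs and their degrees\<close>

text \<open>
  A supergraph that is maximal among those without the required tree exists because the complete
  graph has it. By maximality the closure step must fail for each non-adjacent pair, which bounds all
  degree sums of such pairs.
\<close>

lemma saturated_supergraph:
  assumes V: "finite V" and E: "sym E" "irrefl E" "E \<subseteq> V \<times> V"
    and S: "S \<subseteq> V" "2 \<le> card S" "card S < card V" and no: "\<not> leaf_tree E V S"
  obtains H where "E \<subseteq> H" "sym H" "irrefl H" "H \<subseteq> V \<times> V" "\<not> leaf_tree H V S"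
    "\<And>x y. x \<in> V \<Longrightarrow> y \<in> V \<Longrightarrow> x \<noteq> y \<Longrightarrow> (x, y) \<notin> H \<Longrightarrow>
      card (H `` {x}) + card (H `` {y}) + 2 \<le> card V + card S"
    "\<exists>x\<in>V. \<exists>y\<in>V. x \<noteq> y \<and> (x, y) \<notin> H"
proof -
  let ?P = "\<lambda>H. E \<subseteq> H \<and> sym H \<and> irrefl H \<and> H \<subseteq> V \<times> V \<and> \<not> leaf_tree H V S"
  have fin: "finite (V \<times> V)" using V by simp
  have "\<forall>H. ?P H \<longrightarrow> card H < Suc (card (V \<times> V))"
  proof (intro allI impI)
    fix H assume "?P H"
    then have "H \<subseteq> V \<times> V" by (elim conjE)
    then have "card H \<le> card (V \<times> V)" by (rule card_mono[OF fin])
    then show "card H < Suc (card (V \<times> V))" by (rule le_imp_less_Suc)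
  qed
  moreover have "?P E" using E no by simp
  ultimately have "\<exists>H. ?P H \<and> (\<forall>H'. ?P H' \<longrightarrow> card H' \<le> card H)"
    by (intro ex_has_greatest_nat[of ?P E])
  then obtain H where H: "?P H" and max: "\<And>H'. ?P H' \<Longrightarrow> card H' \<le> card H"
    by (elim exE conjE) metis
  have "card (H `` {x}) + card (H `` {y}) + 2 \<le> card V + card S"
    if xy: "x \<in> V" "y \<in> V" "x \<noteq> y" "(x, y) \<notin> H" for x y
  proof (rule ccontr)
    assume "\<not> ?thesis"
    then have deg: "card V + card S \<le> card (H `` {x}) + card (H `` {y}) + 1" by simp
    let ?H = "insert (x, y) (insert (y, x) H)"
    have "\<not> leaf_tree ?H V S"
      using leaf_tree_remove_edge[of H V x y S] H xy deg by blast
    then have "?P ?H"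
      using H xy by (auto simp: irrefl_def intro!: symI dest: symD)
    then have "card ?H \<le> card H" by (rule max)
    moreover have "finite H" using H fin finite_subset by blast
    moreover have "card (insert (x, y) H) \<le> card ?H"
      using \<open>finite H\<close> by (intro card_mono) auto
    ultimately show False using xy(4) by simp
  qed
  moreover have "\<exists>x\<in>V. \<exists>y\<in>V. x \<noteq> y \<and> (x, y) \<notin> H"
  proof (rule ccontr)
    assume "\<not> ?thesis"
    then have "leaf_tree H V S"
      using H V S card_mono[of S V] card_Diff_subset[of S V] finite_subset[OF S(1)]
      by (intro leaf_tree_few_inner[of H V V "{}" S]) auto
    then show False using H by blast
  qed
  ultimately show thesis using that H by blast
qed

text \<open>
  Chvatal's argument: among the non-adjacent pairs take \<open>u, v\<close> with the largest degree sum and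
  \<open>i = d(u) \<le> d(v)\<close>. By the choice of the pair, non-neighbours of \<open>v\<close> have degree at most
  \<open>d(u)\<close> and non-neighbours of \<open>u\<close> have degree at most \<open>d(v)\<close>. There are at least
  \<open>a = i + 1 - k\<close> of the former and \<open>n - i\<close> of the latter, and \<open>d(v) \<le> n - 1 - a = b + i - 1\<close>.
\<close>

lemma low_degree_parts:
  assumes V: "finite V" and H: "sym H" "irrefl H" "H \<subseteq> V \<times> V"
    and pairs: "\<And>x y. x \<in> V \<Longrightarrow> y \<in> V \<Longrightarrow> x \<noteq> y \<Longrightarrow> (x, y) \<notin> H \<Longrightarrow>
      card (H `` {x}) + card (H `` {y}) + 2 \<le> card V + k"
    and ex: "\<exists>x\<in>V. \<exists>y\<in>V. x \<noteq> y \<and> (x, y) \<notin> H"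
    and min: "\<And>x. x \<in> V \<Longrightarrow> k + 1 \<le> card (H `` {x})"
  obtains A B C a b i where "A \<union> B \<union> C = V" "A \<inter> B = {}" "A \<inter> C = {}" "B \<inter> C = {}"
    "card A = a" "card B = b" "card C = i" "i + 1 = a + k" "2 \<le> a" "1 \<le> b"
    "\<And>x. x \<in> A \<Longrightarrow> card (H `` {x}) \<le> i" "\<And>x. x \<in> B \<Longrightarrow> card (H `` {x}) + 1 \<le> b + i"
proof -
  let ?f = "\<lambda>x. card (H `` {x})" and ?n = "card V"
  define Q where "Q q \<longleftrightarrow> fst q \<in> V \<and> snd q \<in> V \<and> fst q \<noteq> snd q \<and> q \<notin> H" for q
  define g where "g q = ?f (fst q) + ?f (snd q)" for q
  obtain z where z: "Q z" using ex by (auto simp: Q_def)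
  have "\<forall>q. Q q \<longrightarrow> g q < Suc (?n + k)"
    using pairs by (fastforce simp: Q_def g_def)
  with z have "\<exists>q. Q q \<and> (\<forall>q'. Q q' \<longrightarrow> g q' \<le> g q)"
    by (rule ex_has_greatest_nat)
  then obtain q where q: "Q q" "\<And>q'. Q q' \<Longrightarrow> g q' \<le> g q"
    by blast
  obtain x0 y0 where q0: "q = (x0, y0)" by fastforce
  define u where "u = (if ?f x0 \<le> ?f y0 then x0 else y0)"
  define v where "v = (if ?f x0 \<le> ?f y0 then y0 else x0)"
  have uv: "u \<in> V" "v \<in> V" "u \<noteq> v" "(u, v) \<notin> H" "?f u \<le> ?f v"
    using q(1) H(1) unfolding q0 u_def v_def by (auto simp: Q_def dest: symD)
  have "?f u + ?f v = ?f x0 + ?f y0" unfolding u_def v_def by simp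
  then have max: "?f x + ?f y \<le> ?f u + ?f v" if "x \<in> V" "y \<in> V" "x \<noteq> y" "(x, y) \<notin> H" for x y
    using q(2)[of "(x, y)"] that unfolding q0 by (simp add: Q_def g_def)
  have noself: "(x, x) \<notin> H" for x using H(2) by (auto simp: irrefl_def)
  have sum: "?f u + ?f v + 2 \<le> ?n + k" using pairs[OF uv(1-4)] .
  define i where "i = ?f u"
  define a where "a = i + 1 - k"
  define b where "b = ?n - a - i"
  have i: "k + 1 \<le> i" using min[OF uv(1)] by (simp add: i_def)
  then have a: "i + 1 = a + k" "2 \<le> a" by (auto simp: a_def)
  have b: "a + b + i = ?n" "1 \<le> b" using sum uv(5) a by (auto simp: b_def i_def)
  have sub: "H `` {x} \<subseteq> V" for x using H(3) by auto
  have nonnbrs: "card (V - H `` {x}) = ?n - ?f x" for x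
    using V sub finite_subset card_Diff_subset by metis
  let ?A = "V - H `` {v} - {v}"
  have "card ?A = ?n - ?f v - 1"
    using nonnbrs[of v] uv(2) noself[of v] by (simp add: card_Diff_singleton)
  then have "a \<le> card ?A" using sum a by (simp add: i_def)
  then obtain A where A: "A \<subseteq> ?A" "card A = a" by (meson obtain_subset_with_card_n)
  have Ai: "?f x \<le> i" if "x \<in> A" for x
  proof -
    have "x \<in> V" "x \<noteq> v" "(x, v) \<notin> H" using that A(1) H(1) by (auto dest: symD)
    then show ?thesis using max[of x v] uv(2) by (simp add: i_def)
  qed
  let ?D = "{x \<in> V. ?f x + 1 \<le> b + i}"
  have "V - H `` {u} \<subseteq> ?D"
  proof
    fix x assume x: "x \<in> V - H `` {u}"
    have "?f x \<le> ?f v"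
      using max[of u x] x uv by (cases "x = u") auto
    then show "x \<in> ?D" using x sum a b by (simp add: i_def)
  qed
  then have "?n - i \<le> card ?D" using card_mono[of ?D "V - H `` {u}"] nonnbrs[of u] V by (simp add: i_def)
  moreover have "card ?D \<le> card (?D - A) + card A"
    using V card_mono[of "(?D - A) \<union> A" ?D] card_Un_le[of "?D - A" A] A finite_subset[of A V] by fastforce
  ultimately have "b \<le> card (?D - A)" using A(2) b by linarith
  then obtain B where B: "B \<subseteq> ?D - A" "card B = b" by (meson obtain_subset_with_card_n)
  let ?C = "V - A - B"
  have "A \<subseteq> V" "B \<subseteq> V - A" using A(1) B(1) by auto
  moreover from this have "finite A" "finite B"
    using finite_subset[OF _ V] by blast+
  ultimately have fin: "finite A" "finite B" "A \<subseteq> V" "B \<subseteq> V - A" by auto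
  have "card ?C = i"
    using fin V A(2) B(2) b by (simp add: card_Diff_subset)
  then show thesis
    using that[of A B ?C a b i] A B Ai fin a b by auto
qed

section \<open>The second Zagreb index as a sum over arcs\<close>

text \<open>
  Summing over ordered pairs counts each edge twice, so this is twice the second Zagreb index.
\<close>

definition arc_weight :: "('a \<times> 'a) set \<Rightarrow> nat" where
  "arc_weight E = (\<Sum>(x, y)\<in>E. card (E `` {x}) * card (E `` {y}))"

lemma double_second_zagreb:
  assumes G: "pair_graph G"
  shows "2 * second_zagreb G = arc_weight (parcs G)"
proof -
  let ?s = "\<lambda>(x, y). {x, y}" and ?g = "\<lambda>(x, y). degree G x * degree G y"
  have fin: "finite (parcs G)"
    using parcs_subset[OF G] finite_pverts[OF G] by (meson finite_SigmaI finite_subset)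
  have img: "?s ` parcs G = edges G" by (force simp: edges_def)
  have "sum ?g (parcs G) = (\<Sum>e\<in>edges G. sum ?g {q \<in> parcs G. ?s q = e})"
    unfolding img[symmetric] using sum.image_gen[OF fin] .
  also have "\<dots> = (\<Sum>e\<in>edges G. 2 * (\<Prod>v\<in>e. degree G v))"
  proof (rule sum.cong[OF refl])
    fix e assume "e \<in> edges G"
    then obtain u v where e: "e = {u, v}" "(u, v) \<in> parcs G" by (auto simp: edges_def)
    have "u \<noteq> v" using irrefl_parcs[OF G] e(2) by (auto simp: irrefl_def)
    moreover have "{q \<in> parcs G. ?s q = e} = {(u, v), (v, u)}"
      using e sym_parcs[OF G] by (auto simp: doubleton_eq_iff dest: symD)
    ultimately show "sum ?g {q \<in> parcs G. ?s q = e} = 2 * (\<Prod>v\<in>e. degree G v)"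
      using e(1) by simp
  qed
  finally show ?thesis
    by (simp add: second_zagreb_def arc_weight_def degree_eq_card_Image sum_distrib_left)
qed

lemma arc_weight_mono:
  assumes "E \<subseteq> H" "finite H"
  shows "arc_weight E \<le> arc_weight H"
proof -
  have "finite (H `` {x})" for x
    using finite_subset[of "H `` {x}" "snd ` H"] assms(2) by force
  then have c: "card (E `` {x}) \<le> card (H `` {x})" for x
    using assms(1) by (intro card_mono) auto
  have "arc_weight E \<le> (\<Sum>(x, y)\<in>E. card (H `` {x}) * card (H `` {y}))"
    unfolding arc_weight_def by (intro sum_mono) (auto intro: mult_le_mono c)
  also have "\<dots> \<le> arc_weight H"
    unfolding arc_weight_def using assms by (intro sum_mono2) auto
  finally show ?thesis .
qed

text \<open>
  Arcs from \<open>R\<close> to \<open>L\<close> are counted with their reversals at the vertices of \<open>L\<close>. This lets the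
  degree caps on \<open>L\<close> limit the number of all arcs that touch \<open>L\<close>.
\<close>

lemma arc_weight_split:
  assumes V: "finite V" "L \<union> R = V" "L \<inter> R = {}" and H: "sym H" "H \<subseteq> V \<times> V"
  defines "f \<equiv> \<lambda>x. card (H `` {x})"
  shows "arc_weight H = (\<Sum>x\<in>R. f x * (\<Sum>y\<in>H `` {x} \<inter> R. f y)) +
    (\<Sum>x\<in>L. f x * ((\<Sum>y\<in>H `` {x} \<inter> L. f y) + 2 * (\<Sum>y\<in>H `` {x} \<inter> R. f y)))"
proof -
  have fin: "finite L" "finite R" using V by auto
  let ?g = "\<lambda>x y. if y \<in> H `` {x} then f x * f y else 0"
  have sub: "f x * (\<Sum>y\<in>H `` {x} \<inter> X. f y) = (\<Sum>y\<in>X. ?g x y)" if "finite X" for x X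
    using sum.inter_restrict[OF that, of "\<lambda>y. f x * f y" "H `` {x}"]
    by (simp add: sum_distrib_left Int_commute)
  have "arc_weight H = (\<Sum>(x, y)\<in>Sigma V (\<lambda>x. H `` {x} \<inter> V). f x * f y)"
    unfolding arc_weight_def f_def by (rule sum.cong) (use H(2) in auto)
  also have "\<dots> = (\<Sum>x\<in>V. \<Sum>y\<in>H `` {x} \<inter> V. f x * f y)"
    using V(1) by (intro sum.Sigma[symmetric]) auto
  also have "\<dots> = (\<Sum>x\<in>V. \<Sum>y\<in>V. ?g x y)"
    using sub[OF V(1)] by (simp add: sum_distrib_left)
  also have "\<dots> = (\<Sum>x\<in>L. \<Sum>y\<in>V. ?g x y) + (\<Sum>x\<in>R. \<Sum>y\<in>V. ?g x y)"
    unfolding V(2)[symmetric] using sum.union_disjoint[OF fin V(3)] .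
  also have "\<dots> = (\<Sum>x\<in>L. \<Sum>y\<in>L. ?g x y) + (\<Sum>x\<in>L. \<Sum>y\<in>R. ?g x y) +
      ((\<Sum>x\<in>R. \<Sum>y\<in>L. ?g x y) + (\<Sum>x\<in>R. \<Sum>y\<in>R. ?g x y))"
    unfolding V(2)[symmetric] sum.union_disjoint[OF fin V(3)] sum.distrib ..
  also have "(\<Sum>x\<in>R. \<Sum>y\<in>L. ?g x y) = (\<Sum>x\<in>L. \<Sum>y\<in>R. ?g x y)"
  proof (subst sum.swap, intro sum.cong refl)
    fix x y show "?g y x = ?g x y" using H(1) by (auto simp: mult.commute dest: symD)
  qed
  finally show ?thesis
    unfolding distrib_left mult.left_commute[of "f _" 2] sub[OF fin(1)] sub[OF fin(2)]
    by (simp add: sum.distrib flip: sum_distrib_left)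
qed

section \<open>Comparison with the threshold\<close>

text \<open>
  Half the sum of the cubes of the degrees of \<open>K\<^sub>k\<^sub>+\<^sub>1 \<or> (K\<^sub>n\<^sub>-\<^sub>k\<^sub>-\<^sub>3 + 2K\<^sub>1)\<close>.
\<close>

definition threshold :: "real \<Rightarrow> real \<Rightarrow> real" where
  "threshold n k = (2 * (k + 1) ^ 3 + (n - k - 3) * (n - 3) ^ 3 + (k + 1) * (n - 1) ^ 3) / 2"

lemma threshold_expand:
  "threshold n k = 1 / 2 * n ^ 4 - 11 / 2 * n ^ 3 + (6 * k + 51) / 2 * n ^ 2
      - (24 * k + 105) / 2 * n + k ^ 3 + 3 * k ^ 2 + 16 * k + 41"
  unfolding threshold_def by (simp add: field_simps power2_eq_square power3_eq_cube power4_eq_xxxx)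

text \<open>
  Twice the second Zagreb index of \<open>K\<^sub>i \<or> (K\<^sub>b + aK\<^sub>1)\<close>, a graph on \<open>a + b + i\<close> vertices whose
  three vertex classes have the degrees \<open>a + b + i - 1\<close>, \<open>b + i - 1\<close> and \<open>i\<close>.
\<close>

definition cap_bound :: "real \<Rightarrow> real \<Rightarrow> real \<Rightarrow> real" where
  "cap_bound a b i = (let m = b + i - 1; M = a + b + i - 1 in
     b * m * ((b - 1) * m + i * M) + i * M * (b * m + (i - 1) * M) + 2 * a * i ^ 2 * M)"

text \<open>
  The bound obtained for \<open>b = 1\<close> when one of the \<open>i\<close> vertices of large degree has degree at most
  \<open>n - 3\<close>, where \<open>n = a + i + 1\<close>. The extremal position is that this vertex is adjacent to the other
  \<open>i - 1\<close> and misses two of the \<open>a + 1\<close> vertices of small degree.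
\<close>

definition gap_bound :: "real \<Rightarrow> real \<Rightarrow> real" where
  "gap_bound a i = (let M = a + i; M' = a + i - 2 in
     (i - 1) * (i - 2) * M ^ 2 + M' * ((a - 1) * i + 2 * (i - 1) * M)
     + i * ((a + 1) * (i - 1) * 2 * M + (a - 1) * M' + 2 * i))"

text \<open>
  The comparisons below share one method: shifting the variables by their least values turns the
  difference of the two sides into a positive constant plus terms that are nonnegative.
\<close>

lemma cap_bound_two:
  assumes "2 \<le> b" "3 \<le> i"
  shows "cap_bound 2 b i < 2 * threshold (2 + b + i) (i - 1)"
proof -
  define B S where "B = b - 2" and "S = i - 3"
  then have bi: "b = B + 2" "i = S + 3" and pos: "0 \<le> B" "0 \<le> S" using assms by auto
  have "2 * threshold (2 + b + i) (i - 1) - cap_bound 2 b i =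
    (2 * B\<^sup>2 * S + 6 * B\<^sup>2 + 16 * (B * S) + 48 * B + 26 * S) + 78"
    unfolding bi threshold_def cap_bound_def Let_def
    by (simp add: field_simps power2_eq_square power3_eq_cube power4_eq_xxxx)
  moreover have "0 \<le> 2 * B\<^sup>2 * S + 6 * B\<^sup>2 + 16 * (B * S) + 48 * B + 26 * S"
    using pos by (intro add_nonneg_nonneg mult_nonneg_nonneg) auto
  ultimately show ?thesis by linarith
qed

lemma cap_bound_many:
  assumes "3 \<le> a" "2 \<le> b" "a + 1 \<le> i"
  shows "cap_bound a b i < 2 * threshold (a + b + i) (i + 1 - a)"
proof -
  define A B S where "A = a - 3" and "B = b - 2" and "S = i - a - 1"
  then have abi: "a = A + 3" "b = B + 2" "i = A + S + 4" and pos: "0 \<le> A" "0 \<le> B" "0 \<le> S"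
    using assms by auto
  have "2 * threshold (a + b + i) (i + 1 - a) - cap_bound a b i =
    (8 * A ^ 4 + 22 * A ^ 3 * B + 10 * A ^ 3 * S + 72 * A ^ 3 + 16 * A ^ 2 * B ^ 2
     + 24 * A ^ 2 * B * S + 167 * A ^ 2 * B + 3 * A ^ 2 * S ^ 2 + 58 * A ^ 2 * S + 230 * A ^ 2
     + 4 * A * B ^ 3 + 10 * A * B ^ 2 * S + 73 * A * B ^ 2 + 6 * A * B * S ^ 2 + 110 * A * B * S
     + 410 * A * B + 3 * A * S ^ 2 + 88 * A * S + 316 * A + 4 * B ^ 3 + 12 * B ^ 2 * S
     + 63 * B ^ 2 + 6 * B * S ^ 2 + 102 * B * S + 313 * B + 66 * S) + 228"
    unfolding abi threshold_def cap_bound_def Let_def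
    by (simp add: field_simps power2_eq_square power3_eq_cube power4_eq_xxxx)
  moreover have "0 \<le> (8 * A ^ 4 + 22 * A ^ 3 * B + 10 * A ^ 3 * S + 72 * A ^ 3 + 16 * A ^ 2 * B ^ 2
     + 24 * A ^ 2 * B * S + 167 * A ^ 2 * B + 3 * A ^ 2 * S ^ 2 + 58 * A ^ 2 * S + 230 * A ^ 2
     + 4 * A * B ^ 3 + 10 * A * B ^ 2 * S + 73 * A * B ^ 2 + 6 * A * B * S ^ 2 + 110 * A * B * S
     + 410 * A * B + 3 * A * S ^ 2 + 88 * A * S + 316 * A + 4 * B ^ 3 + 12 * B ^ 2 * S
     + 63 * B ^ 2 + 6 * B * S ^ 2 + 102 * B * S + 313 * B + 66 * S)"
    using pos by (intro add_nonneg_nonneg mult_nonneg_nonneg) auto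
  ultimately show ?thesis by linarith
qed

text \<open>
  The case \<open>k = 2\<close>, \<open>b = 1\<close>, in which \<open>i = a + 1\<close>. The inequality fails for \<open>a = 3\<close>, where the
  bound is attained by \<open>K\<^sub>4 \<or> 4K\<^sub>1\<close>.
\<close>

lemma cap_bound_ham:
  assumes "4 \<le> a"
  shows "cap_bound a 1 (a + 1) < 2 * threshold (2 * a + 2) 2"
proof -
  define A where "A = a - 4"
  then have a: "a = A + 4" and pos: "0 \<le> A" using assms by auto
  have "2 * threshold (2 * a + 2) 2 - cap_bound a 1 (a + 1) =
    (8 * A ^ 4 + 82 * A ^ 3 + 277 * A ^ 2 + 315 * A) + 86"
    unfolding a threshold_def cap_bound_def Let_def
    by (simp add: field_simps power2_eq_square power3_eq_cube power4_eq_xxxx)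
  moreover have "0 \<le> 8 * A ^ 4 + 82 * A ^ 3 + 277 * A ^ 2 + 315 * A"
    using pos by (intro add_nonneg_nonneg mult_nonneg_nonneg) auto
  ultimately show ?thesis by linarith
qed

text \<open>
  Here \<open>a\<close> is a natural number because the polynomial has the summand \<open>3A(A - 1)S\<^sup>2\<close> with
  \<open>A = a - 3\<close>, which is negative for \<open>A\<close> strictly between 0 and 1.
\<close>

lemma gap_bound_less:
  fixes a :: nat and i :: real
  assumes "3 \<le> a" "real a + 1 \<le> i"
  shows "gap_bound a i < 2 * threshold (real a + 1 + i) (i + 1 - real a)"
proof -
  define A S where "A = real a - 3" and "S = i - a - 1"
  then have ai: "real a = A + 3" "i = A + S + 4" and pos: "0 \<le> A" "0 \<le> S" using assms by auto
  have "a = 3 \<or> 4 \<le> a" using assms by auto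
  then have "A = 0 \<or> 1 \<le> A" by (auto simp: A_def)
  then have AA: "0 \<le> A * (A - 1)" by auto
  have "2 * threshold (real a + 1 + i) (i + 1 - real a) - gap_bound a i =
    (8 * A ^ 4 + 10 * A ^ 3 * S + 50 * A ^ 3 + 34 * A ^ 2 * S + 97 * A ^ 2
     + 3 * (A * (A - 1)) * S ^ 2 + 12 * A * S + 95 * A + 52 * S) + 170"
    unfolding ai threshold_def gap_bound_def Let_def
    by (simp add: field_simps power2_eq_square power3_eq_cube power4_eq_xxxx)
  moreover have "0 \<le> 8 * A ^ 4 + 10 * A ^ 3 * S + 50 * A ^ 3 + 34 * A ^ 2 * S + 97 * A ^ 2
     + 3 * (A * (A - 1)) * S ^ 2 + 12 * A * S + 95 * A + 52 * S"
    using pos AA by (intro add_nonneg_nonneg mult_nonneg_nonneg[of _ S]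
      mult_nonneg_nonneg[of _ "S ^ 2"] mult_nonneg_nonneg[of _ "_ ^ _"] mult_nonneg_nonneg[of _ A]) auto
  ultimately show ?thesis by linarith
qed

section \<open>Bounds on the second Zagreb index from degree caps\<close>

lemma sum_capped_le:
  fixes f w :: "'a \<Rightarrow> nat"
  assumes "finite R" "\<And>x. x \<in> R \<Longrightarrow> f x \<le> w x" "\<And>x. x \<in> R \<Longrightarrow> x \<notin> N x"
  shows "(\<Sum>x\<in>R. f x * (\<Sum>y\<in>N x \<inter> R. f y)) \<le> (\<Sum>x\<in>R. w x * (sum w R - w x))"
proof (rule sum_mono)
  fix x assume x: "x \<in> R"
  have "(\<Sum>y\<in>N x \<inter> R. f y) \<le> (\<Sum>y\<in>N x \<inter> R. w y)" by (intro sum_mono assms(2)) auto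
  also have "\<dots> \<le> sum w (R - {x})" using assms(1,3) x by (intro sum_mono2) auto
  also have "\<dots> = sum w R - w x" using x assms(1) by (simp add: sum_diff1_nat)
  finally show "f x * (\<Sum>y\<in>N x \<inter> R. f y) \<le> w x * (sum w R - w x)"
    using assms(2)[OF x] by (intro mult_le_mono)
qed

text \<open>
  Arcs inside \<open>B \<union> C\<close> are bounded as if all pairs were adjacent and all caps attained. Each vertex
  of \<open>A\<close> has at most \<open>i\<close> edges, each of weight at most \<open>i (n - 1)\<close>, where
  \<open>n = a + b + i\<close>.
\<close>

lemma arc_weight_cap:
  assumes V: "finite V" "A \<union> B \<union> C = V" "A \<inter> B = {}" "A \<inter> C = {}" "B \<inter> C = {}"
    and H: "sym H" "irrefl H" "H \<subseteq> V \<times> V"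
    and card: "card A = a" "card B = b" "card C = i" "1 \<le> b" "1 \<le> i"
    and A: "\<And>x. x \<in> A \<Longrightarrow> card (H `` {x}) \<le> i"
    and B: "\<And>x. x \<in> B \<Longrightarrow> card (H `` {x}) + 1 \<le> b + i"
  shows "real (arc_weight H) \<le> cap_bound a b i"
proof -
  let ?f = "\<lambda>x. card (H `` {x})" and ?R = "B \<union> C"
  define m where "m = b + i - 1"
  define M where "M = a + b + i - 1"
  have fin: "finite A" "finite B" "finite C" using V by auto
  have "card V = a + b + i"
    using V card fin card_Un_disjoint[of "A \<union> B" C] card_Un_disjoint[of A B] by (simp add: Int_Un_distrib2)
  moreover have "?f x \<le> card V - 1" if "x \<in> V" for x
  proof -
    have "H `` {x} \<subseteq> V - {x}" using H(2,3) by (auto simp: irrefl_def)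
    then have "?f x \<le> card (V - {x})" using V(1) by (intro card_mono) auto
    then show ?thesis using that V(1) by simp
  qed
  ultimately have fM: "?f x \<le> M" if "x \<in> V" for x using that by (simp add: M_def)
  have Bm: "?f x \<le> m" if "x \<in> B" for x using B[OF that] by (simp add: m_def)
  let ?w = "\<lambda>x. if x \<in> B then m else M"
  have w: "sum ?w ?R = b * m + i * M"
  proof -
    have "sum ?w C = i * M" using card V(5) by (subst sum.cong[of C C _ "\<lambda>_. M"]) auto
    moreover have "sum ?w B = b * m" using card by simp
    ultimately show ?thesis using sum.union_disjoint[OF fin(2,3) V(5), of ?w] by simp
  qed
  have mM: "m \<le> b * m" "M \<le> i * M" using card by auto
  have "(\<Sum>x\<in>?R. ?f x * (\<Sum>y\<in>H `` {x} \<inter> ?R. ?f y)) \<le> (\<Sum>x\<in>?R. ?w x * (sum ?w ?R - ?w x))"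
    using fin Bm fM V(2) H(2) by (intro sum_capped_le) (auto simp: irrefl_def)
  also have "\<dots> = (\<Sum>x\<in>B. m * (b * m + i * M - m)) + (\<Sum>x\<in>C. M * (b * m + i * M - M))"
    unfolding w sum.union_disjoint[OF fin(2,3) V(5)]
    by (intro arg_cong2[where f = "(+)"] sum.cong) (use V(5) in auto)
  also have "\<dots> = b * (m * (b * m + i * M - m)) + i * (M * (b * m + i * M - M))"
    using card by simp
  finally have R: "(\<Sum>x\<in>?R. ?f x * (\<Sum>y\<in>H `` {x} \<inter> ?R. ?f y)) \<le>
    b * (m * (b * m + i * M - m)) + i * (M * (b * m + i * M - M))" .
  have "(\<Sum>x\<in>A. ?f x * ((\<Sum>y\<in>H `` {x} \<inter> A. ?f y) + 2 * (\<Sum>y\<in>H `` {x} \<inter> ?R. ?f y))) \<le>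
    (\<Sum>x\<in>A. i * (i * (2 * M)))"
  proof (intro sum_mono mult_le_mono A)
    fix x assume x: "x \<in> A"
    have "H `` {x} = H `` {x} \<inter> A \<union> H `` {x} \<inter> ?R" using H(3) V(2) by auto
    moreover have "card (H `` {x} \<inter> A \<union> H `` {x} \<inter> ?R) = card (H `` {x} \<inter> A) + card (H `` {x} \<inter> ?R)"
      by (rule card_Un_disjoint) (use fin V in auto)
    ultimately have c: "card (H `` {x} \<inter> A) + card (H `` {x} \<inter> ?R) \<le> i" using A[OF x] by simp
    have "(\<Sum>y\<in>H `` {x} \<inter> A. ?f y) \<le> card (H `` {x} \<inter> A) * M"
      using sum_bounded_above[of "H `` {x} \<inter> A" ?f M] fM V(2) by auto
    moreover have "(\<Sum>y\<in>H `` {x} \<inter> ?R. ?f y) \<le> card (H `` {x} \<inter> ?R) * M"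
      using sum_bounded_above[of "H `` {x} \<inter> ?R" ?f M] fM V(2) by auto
    ultimately have "(\<Sum>y\<in>H `` {x} \<inter> A. ?f y) + 2 * (\<Sum>y\<in>H `` {x} \<inter> ?R. ?f y) \<le>
      (card (H `` {x} \<inter> A) + card (H `` {x} \<inter> ?R)) * (2 * M)"
      by (simp add: algebra_simps)
    also have "\<dots> \<le> i * (2 * M)" using c by (rule mult_le_mono1)
    finally show "(\<Sum>y\<in>H `` {x} \<inter> A. ?f y) + 2 * (\<Sum>y\<in>H `` {x} \<inter> ?R. ?f y) \<le> i * (2 * M)" .
  qed
  also have "\<dots> = a * (i * (i * (2 * M)))" using card by simp
  finally have "arc_weight H \<le> b * (m * (b * m + i * M - m)) + i * (M * (b * m + i * M - M))
    + a * (i * (i * (2 * M)))"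
    using arc_weight_split[of V A ?R H] V H R by (auto simp: Un_assoc Int_Un_distrib)
  then have "real (arc_weight H) \<le> real (b * (m * (b * m + i * M - m)) + i * (M * (b * m + i * M - M))
    + a * (i * (i * (2 * M))))" by (rule of_nat_mono)
  also have "\<dots> = cap_bound a b i"
    unfolding cap_bound_def Let_def
  proof -
    have r: "real m = real b + real i - 1" "real M = real a + real b + real i - 1"
      using card by (auto simp: m_def M_def)
    have "real (b * m + i * M - m) = (real b - 1) * real m + real i * real M"
      "real (b * m + i * M - M) = real b * real m + (real i - 1) * real M"
      using trans_le_add1[OF mM(1), of "i * M"] trans_le_add2[OF mM(2), of "b * m"]
      by (simp_all add: of_nat_diff algebra_simps)
    then show "real (b * (m * (b * m + i * M - m)) + i * (M * (b * m + i * M - M))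
        + a * (i * (i * (2 * M)))) =
      real b * (real b + real i - 1) * ((real b - 1) * (real b + real i - 1)
        + real i * (real a + real b + real i - 1)) +
      real i * (real a + real b + real i - 1) * (real b * (real b + real i - 1)
        + (real i - 1) * (real a + real b + real i - 1)) +
      2 * real a * (real i)\<^sup>2 * (real a + real b + real i - 1)"
      unfolding r[symmetric] by (simp add: power2_eq_square mult_ac)
  qed
  finally show ?thesis .
qed

text \<open>
  The vertex \<open>c\<close> is treated together with \<open>L\<close>. Its \<open>m\<close> neighbours in \<open>L\<close> and \<open>t\<close> neighbours in \<open>C\<close>
  number at most \<open>a + i - 2\<close> in total; the bound is linear in \<open>m\<close> and \<open>t\<close>, and neighbours in \<open>C\<close>
  contribute more, so the maximum is at \<open>t = i - 1\<close> and \<open>m = a - 1\<close>.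
\<close>

lemma arc_weight_gap:
  assumes V: "finite V" "L \<union> C = V" "L \<inter> C = {}"
    and H: "sym H" "irrefl H" "H \<subseteq> V \<times> V"
    and card: "card L = a + 1" "card C = i" "2 \<le> a" "2 \<le> i"
    and L: "\<And>x. x \<in> L \<Longrightarrow> card (H `` {x}) \<le> i"
    and c: "c \<in> C" "card (H `` {c}) + 2 \<le> a + i"
  shows "real (arc_weight H) \<le> gap_bound a i"
proof -
  let ?f = "\<lambda>x. card (H `` {x})" and ?R = "C - {c}" and ?L = "insert c L"
  define M where "M = a + i"
  define M' where "M' = a + i - 2"
  have fin: "finite L" "finite C" using V by auto
  have noself: "(x, x) \<notin> H" for x using H(2) by (auto simp: irrefl_def)
  have "card V = a + i + 1" using V card fin card_Un_disjoint[of L C] by simp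
  moreover have "?f x \<le> card V - 1" if "x \<in> V" for x
  proof -
    have "H `` {x} \<subseteq> V - {x}" using H(2,3) by (auto simp: irrefl_def)
    then have "?f x \<le> card (V - {x})" using V(1) by (intro card_mono) auto
    then show ?thesis using that V(1) by simp
  qed
  ultimately have fM: "?f x \<le> M" if "x \<in> V" for x using that by (simp add: M_def)
  have fc: "?f c \<le> M'" using c(2) by (simp add: M'_def)
  have cR: "card ?R = i - 1" using c(1) card fin by simp
  have sumR: "(\<Sum>y\<in>H `` {x} \<inter> ?R. ?f y) \<le> card (H `` {x} \<inter> ?R) * M" for x
    using sum_bounded_above[of "H `` {x} \<inter> ?R" ?f M] fM V(2) by auto
  have sumL: "(\<Sum>y\<in>H `` {x} \<inter> L. ?f y) \<le> card (H `` {x} \<inter> L) * i" for x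
    using sum_bounded_above[of "H `` {x} \<inter> L" ?f i] L by auto
  define m where "m = card (H `` {c} \<inter> L)"
  define t where "t = card (H `` {c} \<inter> ?R)"
  have "H `` {c} = (H `` {c} \<inter> L) \<union> (H `` {c} \<inter> ?R)" using H(3) V(2) noself by auto
  moreover have "card ((H `` {c} \<inter> L) \<union> (H `` {c} \<inter> ?R)) = m + t"
    unfolding m_def t_def by (rule card_Un_disjoint) (use fin V(3) in auto)
  ultimately have "?f c = m + t" by simp
  then have mt: "m + t \<le> M'" using fc by simp
  have t: "t \<le> i - 1" unfolding t_def cR[symmetric] using fin by (intro card_mono) auto
  have m: "m \<le> a + 1" unfolding m_def card(1)[symmetric] using fin by (intro card_mono) auto
  have "(\<Sum>x\<in>?R. ?f x * (\<Sum>y\<in>H `` {x} \<inter> ?R. ?f y)) \<le>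
      (\<Sum>x\<in>?R. M * (sum (\<lambda>_. M) ?R - M))"
    using fin fM V(2) noself by (intro sum_capped_le) auto
  also have "\<dots> = (i - 1) * (M * ((i - 1) * M - M))" using cR by simp
  finally have 1: "(\<Sum>x\<in>?R. ?f x * (\<Sum>y\<in>H `` {x} \<inter> ?R. ?f y)) \<le> (i - 1) * (M * ((i - 1) * M - M))" .
  let ?g = "\<lambda>x. (\<Sum>y\<in>H `` {x} \<inter> ?L. ?f y) + 2 * (\<Sum>y\<in>H `` {x} \<inter> ?R. ?f y)"
  have "H `` {c} \<inter> ?L = H `` {c} \<inter> L" using noself by auto
  then have "?g c \<le> m * i + 2 * (t * M)"
    using sumL[of c] sumR[of c] unfolding m_def t_def by simp
  then have 2: "?f c * ?g c \<le> M' * (m * i + 2 * (t * M))" using fc by (intro mult_le_mono)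
  have gx: "?g x \<le> 2 * M * (i - 1) + (if x \<in> H `` {c} then M' else i)" if x: "x \<in> L" for x
  proof -
    define q where "q = card (H `` {x} \<inter> ?R)"
    define r where "r = card (H `` {x} \<inter> L)"
    have q: "q \<le> i - 1" unfolding q_def cR[symmetric] using fin by (intro card_mono) auto
    have iM: "i \<le> 2 * M" by (simp add: M_def)
    have xc: "x \<in> H `` {c} \<longleftrightarrow> c \<in> H `` {x}" using H(1) by (auto dest: symD)
    have R: "2 * (\<Sum>y\<in>H `` {x} \<inter> ?R. ?f y) \<le> q * (2 * M)" using sumR[of x] unfolding q_def by simp
    have qr: "card ((H `` {x} \<inter> ?R) \<union> (H `` {x} \<inter> L)) = q + r"
      unfolding q_def r_def by (rule card_Un_disjoint) (use fin V(3) in auto)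
    have fx: "finite (H `` {x})" using H(3) V(1) by (auto intro: finite_subset[of _ V])
    show ?thesis
    proof (cases "c \<in> H `` {x}")
      case True
      have "H `` {x} = insert c ((H `` {x} \<inter> ?R) \<union> (H `` {x} \<inter> L))" using True H(3) V(2) by auto
      moreover have "c \<notin> (H `` {x} \<inter> ?R) \<union> (H `` {x} \<inter> L)" using c V(3) by auto
      ultimately have "?f x = q + r + 1"
        using qr fin by (metis (no_types, lifting) Suc_eq_plus1 card_insert_disjoint finite_Diff finite_Int finite_Un)
      then have "q + r \<le> i - 1" using L[OF x] by simp
      then have "q * (2 * M) + r * (2 * M) \<le> (i - 1) * (2 * M)"
        unfolding add_mult_distrib[symmetric] by (rule mult_le_mono1)
      moreover have "(\<Sum>y\<in>H `` {x} \<inter> L. ?f y) \<le> r * (2 * M)"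
        using sumL[of x, folded r_def] mult_le_mono2[OF iM] by (rule order_trans)
      moreover have "H `` {x} \<inter> ?L = insert c (H `` {x} \<inter> L)" using True by auto
      then have "(\<Sum>y\<in>H `` {x} \<inter> ?L. ?f y) = ?f c + (\<Sum>y\<in>H `` {x} \<inter> L. ?f y)"
        using fin c(1) V(3) by (subst sum.insert[symmetric]) auto
      moreover have "2 * M * (i - 1) = (i - 1) * (2 * M)" by (rule mult.commute)
      ultimately show ?thesis
        using R fc unfolding if_P[OF iffD2[OF xc True]] by linarith
    next
      case False
      have "H `` {x} = (H `` {x} \<inter> ?R) \<union> (H `` {x} \<inter> L)" using False H(3) V(2) by auto
      then have qri: "q + r \<le> i" using qr L[OF x] by simp
      have "q * (2 * M) + r * i \<le> (i - 1) * (2 * M) + i"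
      proof (cases r)
        case 0
        then show ?thesis using trans_le_add1[OF mult_le_mono1[OF q, of "2 * M"]] by simp
      next
        case (Suc r')
        then have "(q + r') * (2 * M) \<le> (i - 1) * (2 * M)" using qri by (intro mult_le_mono1) simp
        moreover have "r' * i \<le> r' * (2 * M)" by (rule mult_le_mono2[OF iM])
        ultimately show ?thesis unfolding Suc by (simp only: add_mult_distrib mult_Suc)
      qed
      moreover have "(\<Sum>y\<in>H `` {x} \<inter> ?L. ?f y) = (\<Sum>y\<in>H `` {x} \<inter> L. ?f y)"
        using False by (intro sum.cong) auto
      moreover have "2 * M * (i - 1) = (i - 1) * (2 * M)" by (rule mult.commute)
      moreover have "x \<notin> H `` {c}" using xc False by blast
      ultimately show ?thesis
        using R sumL[of x, folded r_def] by (simp only: if_False)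
    qed
  qed
  have "(\<Sum>x\<in>L. ?f x * ?g x) \<le> (\<Sum>x\<in>L. i * (2 * M * (i - 1) + (if x \<in> H `` {c} then M' else i)))"
    using L gx by (intro sum_mono mult_le_mono)
  also have "\<dots> = i * ((a + 1) * (2 * M * (i - 1)) + (\<Sum>x\<in>L. if x \<in> H `` {c} then M' else i))"
    using card(1) by (simp add: sum.distrib flip: sum_distrib_left)
  also have "(\<Sum>x\<in>L. if x \<in> H `` {c} then M' else i) = m * M' + (a + 1 - m) * i"
  proof -
    have "card (L - H `` {c}) = a + 1 - m"
      unfolding m_def card(1)[symmetric] by (subst Int_commute) (rule card_Diff_subset_Int, use fin in auto)
    then show ?thesis
      using fin by (simp add: sum.If_cases m_def Int_commute Diff_eq del: Image_singleton_iff)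
  qed
  finally have 3: "(\<Sum>x\<in>L. ?f x * ?g x) \<le>
    i * ((a + 1) * (2 * M * (i - 1)) + (m * M' + (a + 1 - m) * i))" .
  have "arc_weight H = (\<Sum>x\<in>?R. ?f x * (\<Sum>y\<in>H `` {x} \<inter> ?R. ?f y)) + (\<Sum>x\<in>?L. ?f x * ?g x)"
    by (rule arc_weight_split) (use V H c in auto)
  also have "(\<Sum>x\<in>?L. ?f x * ?g x) = ?f c * ?g c + (\<Sum>x\<in>L. ?f x * ?g x)"
    using c(1) V(3) fin by (intro sum.insert) auto
  finally have "arc_weight H \<le> (i - 1) * (M * ((i - 1) * M - M)) + (M' * (m * i + 2 * (t * M)) +
    i * ((a + 1) * (2 * M * (i - 1)) + (m * M' + (a + 1 - m) * i)))" using 1 2 3 by linarith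
  then have "real (arc_weight H) \<le> real ((i - 1) * (M * ((i - 1) * M - M)) + (M' * (m * i + 2 * (t * M)) +
    i * ((a + 1) * (2 * M * (i - 1)) + (m * M' + (a + 1 - m) * i))))" by (rule of_nat_mono)
  also have "\<dots> = (real i - 1) * (M * ((real i - 2) * M)) + (M' * (real m * i + 2 * (t * M)) +
    i * ((real a + 1) * (2 * M * (real i - 1)) + (real m * M' + (real a + 1 - m) * i)))"
  proof -
    have "1 \<le> i - 1" using card(4) by linarith
    then have "M \<le> (i - 1) * M" using mult_le_mono1[of 1 "i - 1" M] by simp
    then have "real ((i - 1) * M - M) = (real i - 2) * M"
      using card(4) by (subst of_nat_diff) (auto simp: of_nat_diff left_diff_distrib)
    moreover have "real (i - 1) = real i - 1" "real (a + 1 - m) = real a + 1 - m"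
      using m card(4) by (auto simp: of_nat_diff)
    ultimately show ?thesis by (simp only: of_nat_add of_nat_mult of_nat_numeral of_nat_1)
  qed
  also have "\<dots> \<le> gap_bound a i"
  proof -
    \<comment> \<open>\<open>D\<close> and \<open>P\<close> are the gains from one more neighbour of \<open>c\<close> in \<open>L\<close> and in \<open>C\<close>\<close>
    define D P where "D = 2 * real i * M' - real i ^ 2" and "P = 2 * real M' * M"
    have M: "real M = real a + i" "real M' = real a + i - 2" using card by (auto simp: M_def M'_def)
    have "0 \<le> real i * (2 * M' - real i)" using card M by (intro mult_nonneg_nonneg) auto
    then have D: "0 \<le> D" by (simp add: D_def power2_eq_square algebra_simps)
    have "0 \<le> real M' * (2 * a) + real i ^ 2" by simp
    then have PD: "0 \<le> P - D" unfolding D_def P_def M(1) by (simp add: algebra_simps)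
    have "0 \<le> D * (real M' - t - m)" using D mt by (intro mult_nonneg_nonneg) auto
    moreover have "0 \<le> (P - D) * (real i - 1 - t)"
      using PD t card(4) by (intro mult_nonneg_nonneg) auto
    moreover have "gap_bound a i - ((real i - 1) * (M * ((real i - 2) * M)) + (M' * (real m * i + 2 * (t * M)) +
        i * ((real a + 1) * (2 * M * (real i - 1)) + (real m * M' + (real a + 1 - m) * i)))) =
      D * (real M' - t - m) + (P - D) * (real i - 1 - t)"
      unfolding gap_bound_def Let_def D_def P_def by (simp add: M algebra_simps power2_eq_square)
    ultimately show ?thesis by linarith
  qed
  finally show ?thesis .
qed

section \<open>The exceptional graph and the theorem\<close>

lemma isomorphicI:
  assumes G: "pair_graph G" and f: "inj_on f (pverts G)"
    "pverts J = f ` pverts G" "parcs J = map_prod f f ` parcs G"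
  shows "isomorphic G J"
proof -
  interpret pair_graph G by fact
  let ?h = "\<lparr>iso_verts = f, iso_arcs = map_prod f f, iso_head = snd, iso_tail = fst\<rparr>"
  have "inj_on (map_prod f f) (parcs G)"
    using inj_on_subset[OF map_prod_inj_on[OF f(1) f(1)] parcs_subset[OF G]] .
  then have "pre_digraph.digraph_isomorphism (with_proj G) ?h"
    unfolding pre_digraph.digraph_isomorphism_def using f(1) wf_digraph_axioms by simp
  moreover have "with_proj J = app_iso ?h (with_proj G)"
    using f by (simp add: app_iso_def with_proj_def)
  ultimately show ?thesis unfolding digraph_iso_def by blast
qed

lemma isomorphic_complete_split:
  assumes G: "pair_graph G" and V: "pverts G = C \<union> L" "C \<inter> L = {}"
    and E: "parcs G = (C \<times> C - Id) \<union> C \<times> L \<union> L \<times> C"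
  shows "isomorphic G (join (complete_graph (card C)) (copies (card L) (complete_graph 1)))"
proof -
  have fin: "finite C" "finite L" using finite_pverts[OF G] V by auto
  obtain g where g: "bij_betw g C {..<card C}"
    using ex_bij_betw_finite_nat[OF fin(1)] by (auto simp: atLeast0LessThan)
  obtain h where h: "bij_betw h L {..<card L}"
    using ex_bij_betw_finite_nat[OF fin(2)] by (auto simp: atLeast0LessThan)
  define f :: "'a \<Rightarrow> nat + nat \<times> nat" where "f x = (if x \<in> C then Inl (g x) else Inr (h x, 0))" for x
  have fL: "f x = Inr (h x, 0)" if "x \<in> L" for x using that V(2) by (auto simp: f_def)
  have fC: "f x = Inl (g x)" if "x \<in> C" for x using that by (simp add: f_def)
  have imC: "f ` C = Inl ` {..<card C}"
  proof -
    have "f ` C = Inl ` g ` C" using fC by (auto simp: image_image)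
    then show ?thesis using g by (auto simp: bij_betw_def)
  qed
  have imL: "f ` L = Inr ` ({..<card L} \<times> {0})"
  proof -
    have "f ` L = (\<lambda>j. Inr (j, 0)) ` h ` L" using fL by (auto simp: image_image)
    then show ?thesis using h by (auto simp: bij_betw_def)
  qed
  have inj: "inj_on f (pverts G)"
  proof (rule inj_onI)
    fix x y assume "x \<in> pverts G" "y \<in> pverts G" "f x = f y"
    then show "x = y"
      using g h fL fC V(1) by (auto simp: bij_betw_def dest: inj_onD) 
  qed
  have injC: "inj_on f C" using inj V(1) by (auto intro: inj_on_subset)
  have "map_prod f f ` (C \<times> C - Id) = f ` C \<times> f ` C - Id"
    using injC by (force simp: inj_on_def)
  then have "map_prod f f ` parcs G =
      (f ` C \<times> f ` C - Id) \<union> f ` C \<times> f ` L \<union> f ` L \<times> f ` C"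
    unfolding E image_Un by (simp add: map_prod_surj_on[OF refl refl])
  also have "\<dots> = parcs (join (complete_graph (card C)) (copies (card L) (complete_graph 1)))"
    unfolding imC imL by (auto simp: join_def disjoint_union_def complete_graph_def copies_def)
  finally have "parcs (join (complete_graph (card C)) (copies (card L) (complete_graph 1)))
    = map_prod f f ` parcs G" by simp
  moreover have "pverts (join (complete_graph (card C)) (copies (card L) (complete_graph 1)))
    = f ` pverts G"
    unfolding V(1) image_Un imC imL
    by (auto simp: join_def disjoint_union_def complete_graph_def copies_def Plus_def)
  ultimately show ?thesis using isomorphicI[OF G inj] by blast
qed

text \<open>
  Each vertex of \<open>C\<close> contributes at most 147 to the arcs inside \<open>C\<close>, and each vertex of \<open>L\<close>
  contributes at most 224 to the arcs that touch \<open>L\<close>; together this is 1484. A missing pair inside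
  \<open>C\<close> or between \<open>C\<close> and \<open>L\<close> costs at least 40, more than the 26 that are available.
\<close>

lemma complete_split_eight:
  assumes V: "finite V" "L \<union> C = V" "L \<inter> C = {}" "card L = 4" "card C = 4"
    and H: "sym H" "irrefl H" "H \<subseteq> V \<times> V"
    and L: "\<And>x. x \<in> L \<Longrightarrow> card (H `` {x}) \<le> 4"
    and weight: "1458 \<le> arc_weight H"
  shows "H = (C \<times> C - Id) \<union> C \<times> L \<union> L \<times> C"
proof -
  let ?f = "\<lambda>x. card (H `` {x})"
  let ?c = "\<lambda>x. card (H `` {x} \<inter> C)" and ?l = "\<lambda>x. card (H `` {x} \<inter> L)"
  have fin: "finite L" "finite C" using V by auto
  have noself: "(x, x) \<notin> H" for x using H(2) by (auto simp: irrefl_def)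
  have cardV: "card V = 8" using V fin card_Un_disjoint[of L C] by simp
  have f7: "?f x \<le> 7" if "x \<in> V" for x
  proof -
    have "H `` {x} \<subseteq> V - {x}" using H(3) noself by auto
    then have "?f x \<le> card (V - {x})" using V(1) by (intro card_mono) auto
    then show ?thesis using that V(1) cardV by simp
  qed
  have sumC: "(\<Sum>y\<in>H `` {x} \<inter> C. ?f y) \<le> ?c x * 7" for x
    using sum_bounded_above[of "H `` {x} \<inter> C" ?f 7] f7 V(2) by auto
  have sumL: "(\<Sum>y\<in>H `` {x} \<inter> L. ?f y) \<le> ?l x * 4" for x
    using sum_bounded_above[of "H `` {x} \<inter> L" ?f 4] L by auto
  have c3: "?c x \<le> 3" if "x \<in> C" for x
  proof -
    have "?c x \<le> card (C - {x})" using fin noself by (intro card_mono) auto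
    then show ?thesis using that V(5) fin by simp
  qed
  have c4: "?c x + ?l x \<le> 4" if "x \<in> L" for x
  proof -
    have "H `` {x} = (H `` {x} \<inter> C) \<union> (H `` {x} \<inter> L)" using H(3) V(2) by auto
    moreover have "card ((H `` {x} \<inter> C) \<union> (H `` {x} \<inter> L)) = ?c x + ?l x"
      by (rule card_Un_disjoint) (use fin V(3) in auto)
    ultimately show ?thesis using L[OF that] by simp
  qed
  let ?P = "\<lambda>x. ?f x * (\<Sum>y\<in>H `` {x} \<inter> C. ?f y)"
  let ?Q = "\<lambda>x. ?f x * ((\<Sum>y\<in>H `` {x} \<inter> L. ?f y) + 2 * (\<Sum>y\<in>H `` {x} \<inter> C. ?f y))"
  have P: "?P x \<le> 49 * ?c x" if "x \<in> C" for x
    using mult_le_mono[OF f7 sumC, of x x] that V(2) by auto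
  have Q: "?Q x \<le> 16 * ?l x + 56 * ?c x" if "x \<in> L" for x
  proof -
    have "?Q x \<le> 4 * (?l x * 4 + 2 * (?c x * 7))"
      using sumC[of x] sumL[of x] by (intro mult_le_mono L that add_mono) auto
    then show ?thesis by simp
  qed
  have split: "arc_weight H = sum ?P C + sum ?Q L"
    using arc_weight_split[OF V(1-3) H(1,3)] .
  have P147: "?P x \<le> 147" if "x \<in> C" for x using P[OF that] c3[OF that] by simp
  have Q224: "?Q x \<le> 224" if "x \<in> L" for x using Q[OF that] c4[OF that] by simp
  have sumP: "sum ?P C \<le> 588" using sum_bounded_above[of C ?P 147] P147 V(5) by simp
  have sumQ: "sum ?Q L \<le> 896" using sum_bounded_above[of L ?Q 224] Q224 V(4) by simp
  have C3: "?c x = 3" if x: "x \<in> C" for x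
  proof (rule ccontr)
    assume "?c x \<noteq> 3"
    then have "?P x \<le> 98" using P[OF x] c3[OF x] by simp
    moreover have "sum ?P (C - {x}) \<le> 441"
      using sum_bounded_above[of "C - {x}" ?P 147] P147 V(5) x fin by simp
    moreover have "sum ?P C = ?P x + sum ?P (C - {x})" using fin x by (intro sum.remove) auto
    ultimately show False using split sumQ weight by linarith
  qed
  have L4: "?c x = 4" if x: "x \<in> L" for x
  proof (rule ccontr)
    assume "?c x \<noteq> 4"
    then have "?Q x \<le> 184" using Q[OF x] c4[OF x] by simp
    moreover have "sum ?Q (L - {x}) \<le> 672"
      using sum_bounded_above[of "L - {x}" ?Q 224] Q224 V(4) x fin by simp
    moreover have "sum ?Q L = ?Q x + sum ?Q (L - {x})" using fin x by (intro sum.remove) auto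
    ultimately show False using split sumP weight by linarith
  qed
  have HC: "H `` {x} \<inter> C = C - {x}" if "x \<in> C" for x
    using fin C3[OF that] that V(5) noself by (intro card_subset_eq) auto
  have HL: "H `` {x} = C" if "x \<in> L" for x
  proof -
    have "H `` {x} \<inter> C = C" using fin L4[OF that] V(5) by (intro card_subset_eq) auto
    moreover have "?l x = 0" using c4[OF that] L4[OF that] by simp
    then have "H `` {x} \<inter> L = {}" using fin by simp
    ultimately show ?thesis using H(3) V(2) by auto
  qed
  show ?thesis
  proof (intro set_eqI iffI)
    fix e assume "e \<in> H"
    moreover obtain x y where "e = (x, y)" by fastforce
    ultimately show "e \<in> (C \<times> C - Id) \<union> C \<times> L \<union> L \<times> C"
      using H(3) V(2) HL noself by auto
  next
    fix e assume e: "e \<in> (C \<times> C - Id) \<union> C \<times> L \<union> L \<times> C"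
    obtain x y where xy: "e = (x, y)" by fastforce
    have "(x, y) \<in> H" if "x \<in> L" "y \<in> C" for x y using HL[OF that(1)] that(2) by auto
    then show "e \<in> H" using e HC[of x] H(1) unfolding xy by (auto dest: symD)
  qed
qed

theorem theorem3p4:
  fixes G :: "'a pair_pre_digraph" and n k :: nat
  assumes "2 \<le> k" and "k + 5 \<le> n"
    and "pair_graph G" and "Digraph_Component.connected (with_proj G)"
    and "card (pverts G) = n"
    and "k + 1 \<le> min_degree G"
    and "real (second_zagreb G) \<ge>
      1 / 2 * real n ^ 4 - 11 / 2 * real n ^ 3 + (6 * real k + 51) / 2 * real n ^ 2
      - (24 * real k + 105) / 2 * real n
      + real k ^ 3 + 3 * real k ^ 2 + 16 * real k + 41"
  shows "k_leaf_connected k G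
    \<or> isomorphic G (join (complete_graph 5) (copies 5 (complete_graph 1)))
    \<or> isomorphic G (join (complete_graph 4) (copies 4 (complete_graph 1)))"
proof (cases "k_leaf_connected k G")
  case False
  note G = \<open>pair_graph G\<close>
  let ?V = "pverts G" and ?E = "parcs G"
  have V: "finite ?V" and E: "sym ?E" "irrefl ?E" "?E \<subseteq> ?V \<times> ?V"
    using finite_pverts[OF G] sym_parcs[OF G] irrefl_parcs[OF G] parcs_subset[OF G] by auto
  obtain S where S: "S \<subseteq> ?V" "card S = k" "\<not> leaf_tree ?E ?V S"
    using False assms(2,5) undirected_spanning_treeI[OF G] unfolding k_leaf_connected_def by auto
  obtain H where H: "?E \<subseteq> H" "sym H" "irrefl H" "H \<subseteq> ?V \<times> ?V" "\<not> leaf_tree H ?V S"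
    and pairs: "\<And>x y. x \<in> ?V \<Longrightarrow> y \<in> ?V \<Longrightarrow> x \<noteq> y \<Longrightarrow> (x, y) \<notin> H \<Longrightarrow>
      card (H `` {x}) + card (H `` {y}) + 2 \<le> card ?V + card S"
    and ex: "\<exists>x\<in>?V. \<exists>y\<in>?V. x \<noteq> y \<and> (x, y) \<notin> H"
    using saturated_supergraph[OF V E S(1) _ _ S(3)] assms(1,2,5) S(2) by auto
  have sub: "?E `` {x} \<subseteq> H `` {x}" "finite (H `` {x})" for x
    using H(1,4) V by (auto intro: finite_subset[of _ ?V])
  have min: "k + 1 \<le> card (H `` {x})" if "x \<in> ?V" for x
  proof -
    have "min_degree G \<le> degree G x" unfolding min_degree_def using V that by (intro Min_le) auto
    then show ?thesis
      using assms(6) card_mono[OF sub(2,1)[of x]] by (simp add: degree_eq_card_Image)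
  qed
  obtain A B C a b i where parts: "A \<union> B \<union> C = ?V" "A \<inter> B = {}" "A \<inter> C = {}" "B \<inter> C = {}"
    and card: "card A = a" "card B = b" "card C = i" and ai: "i + 1 = a + k" "2 \<le> a" "1 \<le> b"
    and A: "\<And>x. x \<in> A \<Longrightarrow> card (H `` {x}) \<le> i"
    and B: "\<And>x. x \<in> B \<Longrightarrow> card (H `` {x}) + 1 \<le> b + i"
  proof (rule low_degree_parts[OF V H(2-4) _ ex])
    show "card (H `` {x}) + card (H `` {y}) + 2 \<le> card ?V + k"
      if "x \<in> ?V" "y \<in> ?V" "x \<noteq> y" "(x, y) \<notin> H" for x y
      using pairs[OF that] S(2) by simp
    show "k + 1 \<le> card (H `` {x})" if "x \<in> ?V" for x using min[OF that] .
  qed (rule that; assumption)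
  have fin: "finite A" "finite B" "finite C" using V parts(1) by (metis finite_Un)+
  have n: "n = a + b + i"
    using card_Un_disjoint[of "A \<union> B" C] card_Un_disjoint[of A B] parts fin card assms(5)
    by (simp add: Int_Un_distrib2)
  have finH: "finite H" using H(4) V by (meson finite_SigmaI finite_subset)
  have nr: "real n = real a + real b + real i" and kr: "real k = real i + 1 - real a"
    using n ai by auto
  have wE: "2 * threshold (real n) (real k) \<le> arc_weight ?E"
  proof -
    have "threshold (real n) (real k) \<le> real (second_zagreb G)"
      unfolding threshold_expand by (rule assms(7))
    moreover have "real (arc_weight ?E) = 2 * real (second_zagreb G)"
      unfolding double_second_zagreb[OF G, symmetric] by simp
    ultimately show ?thesis by linarith
  qed
  have wH: "2 * threshold (real n) (real k) \<le> arc_weight H"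
    using wE of_nat_mono[OF arc_weight_mono[OF H(1) finH], where 'a = real] by linarith
  have cap: "2 * threshold (real n) (real k) \<le> cap_bound a b i"
  proof -
    have "1 \<le> i" using ai assms(1) by linarith
    then have "real (arc_weight H) \<le> cap_bound a b i"
      using arc_weight_cap[OF V parts H(2-4) card ai(3)] A B by blast
    then show ?thesis using wH by linarith
  qed
  \<comment> \<open>for \<open>a = 2\<close> the hypothesis \<open>k + 5 \<le> n\<close> forces \<open>b \<ge> 2\<close>\<close>
  have "b = 1 \<and> 3 \<le> a"
  proof (rule ccontr)
    assume "\<not> (b = 1 \<and> 3 \<le> a)"
    then consider "a = 2" "2 \<le> b" "3 \<le> i" | "3 \<le> a" "2 \<le> b" "a + 1 \<le> i"
      using ai n assms(1,2) by linarith
    then show False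
    proof cases
      case 1
      then show False using cap_bound_two[of b i] cap unfolding nr kr by simp
    next
      case 2
      then show False using cap_bound_many[of a b i] cap unfolding nr kr by simp
    qed
  qed
  then have b: "b = 1" and a: "3 \<le> a" by auto
  let ?L = "A \<union> B"
  have L: "?L \<union> C = ?V" "?L \<inter> C = {}" "card ?L = a + 1"
    using parts fin card b card_Un_disjoint[of A B] by auto
  have Li: "card (H `` {x}) \<le> i" if "x \<in> ?L" for x using that A B[of x] b by auto
  \<comment> \<open>a vertex that misses another one misses at least two, as the other has degree at least \<open>k + 1\<close>\<close>
  have univ: "(c, y) \<in> H" if c: "c \<in> C" and y: "y \<in> ?V" "y \<noteq> c" for c y
  proof (rule ccontr)
    assume "(c, y) \<notin> H"
    then have "card (H `` {c}) + card (H `` {y}) + 2 \<le> n + k"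
      using pairs[of c y] c y L(1) assms(5) S(2) by auto
    then have "card (H `` {c}) + 2 \<le> a + i" using min[OF y(1)] n b by linarith
    then have "real (arc_weight H) \<le> gap_bound a i"
      using arc_weight_gap[OF V L(1,2) H(2-4) L(3) card(3) _ _ Li c] a ai assms(1) by auto
    moreover have "gap_bound a i < 2 * threshold (real n) (real k)"
      using gap_bound_less[of a i] a ai assms(1) unfolding nr kr b by simp
    ultimately show False using wH by linarith
  qed
  have k: "k = 2"
  proof (rule ccontr)
    assume "k \<noteq> 2"
    then have "leaf_tree H ?V S"
      using L S(1,2) ai a assms(1) card(3)
      by (intro leaf_tree_universal_part[OF H(2) univ V, of C ?L S]) auto
    then show False using H(5) by blast
  qed
  then have i: "i = a + 1" using ai by simp
  have "a = 3"
  proof (rule ccontr)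
    assume "a \<noteq> 3"
    then show False using cap_bound_ham[of a] cap a unfolding nr k i b by (simp add: algebra_simps)
  qed
  then have eight: "card ?L = 4" "card C = 4" "n = 8" using L(3) i card(3) n b by auto
  have "card (?E `` {x}) \<le> 4" if "x \<in> ?L" for x
    using Li[OF that] card_mono[OF sub(2,1)[of x]] i \<open>a = 3\<close> by simp
  moreover have "1458 \<le> arc_weight ?E"
    using wE unfolding eight(3) k threshold_def by simp
  ultimately have "?E = (C \<times> C - Id) \<union> C \<times> ?L \<union> ?L \<times> C"
    by (intro complete_split_eight[OF V L(1,2) eight(1,2) E])
  then have "isomorphic G (join (complete_graph (card C)) (copies (card ?L) (complete_graph 1)))"
    using L(1,2) by (intro isomorphic_complete_split[OF G]) auto
  then show ?thesis unfolding eight by blast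
qed blast

end
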